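(* Suppose the following boundedness and regularity conditions hold: there are positive constants $\kappa_f,\kappa_{\nabla f},\kappa_c,\kappa_{\nabla c},\kappa_{\nabla^2c}$ with $|f(x)|\le\kappa_f$, $\|\nabla f(x)\|\le\kappa_{\nabla f}$, $\|c(x)\|\le\kappa_c$, $\|\nabla c(x)\|\le\kappa_{\nabla c}$, $\|\nabla^2c(x)\|\le\kappa_{\nabla^2c}$ for all $x\in\mathcal X$; and there is $C_{\rm reg}>0$ with $C_{\rm reg}\|c(x)\|\le\|\mathrm{proj}_{T_{\mathcal X}(x)}(-\nabla c(x)^\top c(x))\|$ for all $x\in\mathcal X$. Let $\{x_k\}$ be the sequence of iterates generated by the MESCAL algorithm with initial iterate $x_{-1}\in\mathcal X$ and initial dual iterate $\lambda_0\in\mathbb R^m$. Suppose the dual bound parameters $\gamma_k>0$ form a bounded sequence with $\sum_{k=0}^\infty\gamma_k=C_\gamma<\infty$, and the dual sample sizes satisfy $|S^{(d)}_k|\ge 1$ for all $k\ge 0$. Suppose the error tolerances satisfy $\epsilon^{(g)}_k\le\epsilon^{(g)}<1$ and $\epsilon^{(H)}_k\le\epsilon^{(H)}<1$ for all $k\ge0$. Let $\Lambda:=\|\lambda_0\|+C_\gamma$ and $$K^*:=\left\lceil\log_\beta\left(\frac{1+\kappa_{\nabla f}+\kappa_{\nabla c}\Lambda}{C_{\rm reg}\,\alpha_0\,\epsilon^{(g)}}\right)\right\rceil=\mathcal O\big(\log(1/\epsilon^{(g)})\big).$$ Then for every iteration $K\ge K^*$, $x_K$ satisfies the following. (i) If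 Option I is used in MESCAL, then $x_K$ is an $(\epsilon^{(g)},\epsilon^{(H)})$-accurate expected second-order stationary point, with $\tilde\lambda:=\lambda_K+\alpha_Kc(x_K)$. (ii) If Option II is used in MESCAL with $p_k=p$ for all $k\ge0$, then $x_K$ is an $(\epsilon^{(g)},\epsilon^{(H)})$-accurate $p$-probabilistic second-order stationary point, with $\tilde\lambda:=\lambda_K+\alpha_Kc(x_K)$.
   Context: Problem. Minimize $f(x)=\mathbb E_\xi[F(x,\xi)]$ over $x\in\mathcal X$ subject to $c(x)=\mathbb E_\zeta[C(x,\zeta)]=0$, where $\mathcal X\subseteq\mathbb R^d$ is closed and convex, $f:\mathbb R^d\to\mathbb R$ and $c:\mathbb R^d\to\mathbb R^m$ are twice continuously differentiable and possibly nonconvex, and $\xi\sim\mathcal P_\xi$, $\zeta\sim\mathcal P_\zeta$. $\nabla c(x)$ is the $m\times d$ Jacobian; $\|\cdot\|$ is the Euclidean vector norm or induced matrix norm; $\|\nabla^2c(x)\|$ is the norm of $\nabla^2c(x)$ as a bilinear map $\mathbb R^d\times\mathbb R^d\to\mathbb R^m$. $T_{\mathcal X}(x)$ is the tangent cone to $\mathcal X$ at $x$, $\mathrm{proj}_{S}$ is Euclidean projection onto $S$, and $T^{(c)}_{\mathcal X}(x):=T_{\mathcal X}(x)\cap\mathrm{Null}(\nabla c(x))$. Superscript $(j)$ denotes the $j$th component. Augmented Lagrangian: $\mathcal L_\alpha(x,\lambda)=f(x)+\lambda^\top c(x)+\frac\alpha2\|c(x)\|^2$; $\nabla$ and $\nabla^2$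 of $\mathcal L_\alpha$ are with respect to $x$. MESCAL. Given $x_{-1}\in\mathcal X$, $\lambda_0\in\mathbb R^m$, $\alpha_0>0$, $\beta>1$, tolerances $\epsilon^{(g)}_k,\epsilon^{(H)}_k>0$, success probabilities $p_k$ (Option II), dual sample sizes $|S_k^{(d)}|$, and dual bounds $\gamma_k>0$, for $k=0,1,\dots$: (1) set $\alpha_k=\alpha_0\beta^k$; (2) starting from $x_{k-1}$, a (stochastic) primal solver for $\min_{x\in\mathcal X}\mathcal L_{\alpha_k}(x,\lambda_k)$ returns $x_k\in\mathcal X$ satisfying, with $\mathcal F_k$ the $\sigma$-algebra generated by all randomness up to the point at which $(x_{k-1},\lambda_k)$ are obtained, either Option I: $\mathbb E[\|\mathrm{proj}_{T_{\mathcal X}(x_k)}(-\nabla\mathcal L_{\alpha_k}(x_k,\lambda_k))\|\mid\mathcal F_k]\le\epsilon^{(g)}_k$ and $\mathbb E[\min_{u\in T_{\mathcal X}(x_k),\|u\|=1}u^\top\nabla^2\mathcal L_{\alpha_k}(x_k,\lambda_k)u\mid\mathcal F_k]\ge-\epsilon^{(H)}_k$; or Option II: with conditional probability given $\mathcal F_k$ at least $p_k$, both $\|\mathrm{proj}_{T_{\mathcal X}(x_k)}(-\nabla\mathcal L_{\alpha_k}(x_k,\lambda_k))\|\le\epsilon^{(g)}_k$ and $\min_{u\in T_{\mathcal X}(x_k),\|u\|=1}u^\top\nabla^2\mathcal L_{\alpha_k}(x_k,\lambda_k)u\ge-\epsilon^{(H)}_k$ hold; (3) draw $|S^{(d)}_k|$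 i.i.d. samples $\zeta_i$ and let $\overline C_k=\frac1{|S^{(d)}_k|}\sum_iC(x_k,\zeta_i)$; (4) set $\lambda_{k+1}=\lambda_k$ if $\overline C_k=0$, and $\lambda_{k+1}=\lambda_k+\min\{\alpha_k,\gamma_k/\|\overline C_k\|\}\,\overline C_k$ otherwise. $\mathbb E$ and $\mathbb P$ denote expectation and probability conditional on $(x_{-1},\lambda_0)$. Expected stationarity. A (possibly random) $\tilde x\in\mathcal X$ is an $(\epsilon^{(g)},\epsilon^{(H)})$-accurate expected second-order stationary point, with a (possibly random) multiplier $\tilde\lambda\in\mathbb R^m$, if $\mathbb E\|\mathrm{proj}_{T_{\mathcal X}(\tilde x)}(-\nabla f(\tilde x)-\nabla c(\tilde x)^\top\tilde\lambda)\|\le\epsilon^{(g)}$, $\mathbb E\|c(\tilde x)\|\le\epsilon^{(g)}$, and $\mathbb E[\min_{u\in T^{(c)}_{\mathcal X}(\tilde x),\|u\|=1}u^\top(\nabla^2f(\tilde x)+\sum_j\tilde\lambda^{(j)}\nabla^2c^{(j)}(\tilde x))u]\ge-\epsilon^{(H)}$. Probabilistic stationarity. $\tilde x$ is an $(\epsilon^{(g)},\epsilon^{(H)})$-accurate $p$-probabilistic second-order stationary point, with multiplier $\tilde\lambda$, if with probability at least $p$ the three events $\|\mathrm{proj}_{T_{\mathcal X}(\tilde x)}(-\nabla f(\tilde x)-\nabla c(\tilde x)^\top\tilde\lambda)\|\le\epsilon^{(g)}$, $\|c(\tilde x)\|\le\epsilon^{(g)}$, and $\min_{u\in T^{(c)}_{\mathcal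 X}(\tilde x),\|u\|=1}u^\top(\nabla^2f(\tilde x)+\sum_j\tilde\lambda^{(j)}\nabla^2c^{(j)}(\tilde x))u\ge-\epsilon^{(H)}$ hold simultaneously. *)

theory Defs
  imports "HOL-Probability.Probability" "HOL-Library.Landau_Symbols"
begin

definition grad :: "(real^'d \<Rightarrow> real) \<Rightarrow> real^'d \<Rightarrow> real^'d" where
  "grad f x = (\<chi> i. frechet_derivative f (at x) (axis i 1))"

definition hess :: "(real^'d \<Rightarrow> real) \<Rightarrow> real^'d \<Rightarrow> real^'d^'d" where
  "hess f x = jacobian (grad f) (at x)"

definition twice_cont_diff :: "(real^'d \<Rightarrow> real) \<Rightarrow> bool" where
  "twice_cont_diff f \<longleftrightarrow>
     (\<forall>x. f differentiable (at x)) \<and>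
     (\<forall>x. grad f differentiable (at x)) \<and>
     continuous_on UNIV (hess f)"

definition second_deriv :: "(real^'d \<Rightarrow> real^'m) \<Rightarrow> real^'d \<Rightarrow> real^'d \<Rightarrow> real^'d \<Rightarrow> real^'m" where
  "second_deriv c x u v = (\<chi> j. u \<bullet> (hess (\<lambda>y. c y $ j) x *v v))"

definition bilinear_norm :: "(real^'d \<Rightarrow> real^'d \<Rightarrow> real^'m) \<Rightarrow> real" where
  "bilinear_norm B = (SUP (u, v) \<in> sphere 0 1 \<times> sphere 0 1. norm (B u v))"

definition aug_lag ::
  "(real^'d \<Rightarrow> real) \<Rightarrow> (real^'d \<Rightarrow> real^'m) \<Rightarrow> real \<Rightarrow> real^'d \<Rightarrow> real^'m \<Rightarrow> real" where
  "aug_lag f c \<alpha> x l = f x + l \<bullet> c x + \<alpha> / 2 * (norm (c x))\<^sup>2"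

definition tangent_cone :: "(real^'d) set \<Rightarrow> real^'d \<Rightarrow> (real^'d) set" where
  "tangent_cone X x = {v. \<exists>y t. (\<forall>n::nat. y n \<in> X \<and> 0 < t n) \<and>
     y \<longlonglongrightarrow> x \<and> t \<longlonglongrightarrow> (0::real) \<and> (\<lambda>n. (y n - x) /\<^sub>R t n) \<longlonglongrightarrow> v}"

definition tangent_cone_null ::
  "(real^'d) set \<Rightarrow> (real^'d \<Rightarrow> real^'m) \<Rightarrow> real^'d \<Rightarrow> (real^'d) set" where
  "tangent_cone_null X c x = tangent_cone X x \<inter> {u. jacobian c (at x) *v u = 0}"

text \<open>The infimum is attained whenever the closed set \<open>T\<close> contains a unit vector. Otherwise the
  minimum is over the empty set and takes the value \<open>\<infinity>\<close>, so that the second-order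
  condition is vacuous; this is the reason for the type \<^typ>\<open>ereal\<close>.\<close>

definition min_curv :: "(real^'d) set \<Rightarrow> real^'d^'d \<Rightarrow> ereal" where
  "min_curv T H = (INF u \<in> {u \<in> T. norm u = 1}. ereal (u \<bullet> (H *v u)))"

definition subproblem_residual ::
  "(real^'d) set \<Rightarrow> (real^'d \<Rightarrow> real) \<Rightarrow> (real^'d \<Rightarrow> real^'m) \<Rightarrow> real \<Rightarrow> real^'d \<Rightarrow> real^'m \<Rightarrow> real" where
  "subproblem_residual X f c \<alpha> x l =
     norm (closest_point (tangent_cone X x) (- grad (\<lambda>y. aug_lag f c \<alpha> y l) x))"

definition subproblem_curv ::
  "(real^'d) set \<Rightarrow> (real^'d \<Rightarrow> real) \<Rightarrow> (real^'d \<Rightarrow> real^'m) \<Rightarrow> real \<Rightarrow> real^'d \<Rightarrow> real^'m \<Rightarrow> ereal" where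
  "subproblem_curv X f c \<alpha> x l =
     min_curv (tangent_cone X x) (hess (\<lambda>y. aug_lag f c \<alpha> y l) x)"

definition kkt_residual ::
  "(real^'d) set \<Rightarrow> (real^'d \<Rightarrow> real) \<Rightarrow> (real^'d \<Rightarrow> real^'m) \<Rightarrow> real^'d \<Rightarrow> real^'m \<Rightarrow> real" where
  "kkt_residual X f c x l =
     norm (closest_point (tangent_cone X x)
       (- grad f x - transpose (jacobian c (at x)) *v l))"

definition kkt_curv ::
  "(real^'d) set \<Rightarrow> (real^'d \<Rightarrow> real) \<Rightarrow> (real^'d \<Rightarrow> real^'m) \<Rightarrow> real^'d \<Rightarrow> real^'m \<Rightarrow> ereal" where
  "kkt_curv X f c x l =
     min_curv (tangent_cone_null X c x)
       (hess f x + (\<Sum>j\<in>UNIV. (l $ j) *\<^sub>R hess (\<lambda>y. c y $ j) x))"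

text \<open>The expectation exists in \<open>[-\<infinity>, \<infinity>]\<close> as soon as one of the positive and negative parts is
  integrable; \<^const>\<open>e2ennreal\<close> maps negative arguments to \<open>0\<close>. The differences
  below are only meaningful under \<open>has_expectation\<close>, because \<open>\<infinity> - \<infinity> = \<infinity>\<close> in
  \<^typ>\<open>ereal\<close>.\<close>

definition has_expectation :: "'w measure \<Rightarrow> ('w \<Rightarrow> ereal) \<Rightarrow> bool" where
  "has_expectation M Y \<longleftrightarrow> Y \<in> borel_measurable M \<and>
     ((\<integral>\<^sup>+ w. e2ennreal (Y w) \<partial>M) < \<infinity> \<or> (\<integral>\<^sup>+ w. e2ennreal (- Y w) \<partial>M) < \<infinity>)"

definition ereal_expectation :: "'w measure \<Rightarrow> ('w \<Rightarrow> ereal) \<Rightarrow> ereal" where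
  "ereal_expectation M Y =
     enn2ereal (\<integral>\<^sup>+ w. e2ennreal (Y w) \<partial>M) - enn2ereal (\<integral>\<^sup>+ w. e2ennreal (- Y w) \<partial>M)"

definition ereal_cond_exp :: "'w measure \<Rightarrow> 'w measure \<Rightarrow> ('w \<Rightarrow> ereal) \<Rightarrow> 'w \<Rightarrow> ereal" where
  "ereal_cond_exp M G Y w =
     enn2ereal (nn_cond_exp M G (\<lambda>v. e2ennreal (Y v)) w) -
     enn2ereal (nn_cond_exp M G (\<lambda>v. e2ennreal (- Y v)) w)"

definition random_pair ::
  "'w measure \<Rightarrow> (real^'d) set \<Rightarrow> ('w \<Rightarrow> real^'d) \<Rightarrow> ('w \<Rightarrow> real^'m) \<Rightarrow> bool" where
  "random_pair M X xt lt \<longleftrightarrow>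
     xt \<in> borel_measurable M \<and> lt \<in> borel_measurable M \<and> (\<forall>w\<in>space M. xt w \<in> X)"

definition expected_sosp ::
  "'w measure \<Rightarrow> (real^'d) set \<Rightarrow> (real^'d \<Rightarrow> real) \<Rightarrow> (real^'d \<Rightarrow> real^'m) \<Rightarrow>
   real \<Rightarrow> real \<Rightarrow> ('w \<Rightarrow> real^'d) \<Rightarrow> ('w \<Rightarrow> real^'m) \<Rightarrow> bool" where
  "expected_sosp M X f c \<epsilon>g \<epsilon>H xt lt \<longleftrightarrow>
     random_pair M X xt lt \<and>
     (\<integral>\<^sup>+ w. ennreal (kkt_residual X f c (xt w) (lt w)) \<partial>M) \<le> ennreal \<epsilon>g \<and>
     (\<integral>\<^sup>+ w. ennreal (norm (c (xt w))) \<partial>M) \<le> ennreal \<epsilon>g \<and>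
     has_expectation M (\<lambda>w. kkt_curv X f c (xt w) (lt w)) \<and>
     ereal_expectation M (\<lambda>w. kkt_curv X f c (xt w) (lt w)) \<ge> - ereal \<epsilon>H"

definition probabilistic_sosp ::
  "'w measure \<Rightarrow> (real^'d) set \<Rightarrow> (real^'d \<Rightarrow> real) \<Rightarrow> (real^'d \<Rightarrow> real^'m) \<Rightarrow>
   real \<Rightarrow> real \<Rightarrow> real \<Rightarrow> ('w \<Rightarrow> real^'d) \<Rightarrow> ('w \<Rightarrow> real^'m) \<Rightarrow> bool" where
  "probabilistic_sosp M X f c \<epsilon>g \<epsilon>H p xt lt \<longleftrightarrow>
     random_pair M X xt lt \<and>
     measure M {w \<in> space M. kkt_residual X f c (xt w) (lt w) \<le> \<epsilon>g \<and>
       norm (c (xt w)) \<le> \<epsilon>g \<and> kkt_curv X f c (xt w) (lt w) \<ge> - ereal \<epsilon>H} \<ge> p"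

text \<open>\<open>\<rho> k\<close> is the (arbitrary) internal randomness of the primal solver in iteration \<open>k\<close>, and
  \<open>\<zeta> k i\<close> with \<open>i < N k\<close> are the dual samples of iteration \<open>k\<close>. Since the initial iterates
  \<open>x\<^sub>-\<^sub>1\<close> and \<open>\<lambda>\<^sub>0\<close> are given, \<open>history k\<close> is the sigma-algebra generated by all randomness up
  to the point at which \<open>x\<^sub>k\<^sub>-\<^sub>1\<close> and \<open>\<lambda>\<^sub>k\<close> are available.\<close>

definition history ::
  "'w measure \<Rightarrow> (nat \<Rightarrow> 'r measure) \<Rightarrow> 'z measure \<Rightarrow> (nat \<Rightarrow> nat) \<Rightarrow>
   (nat \<Rightarrow> 'w \<Rightarrow> 'r) \<Rightarrow> (nat \<Rightarrow> nat \<Rightarrow> 'w \<Rightarrow> 'z) \<Rightarrow> nat \<Rightarrow> 'w measure" where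
  "history M R P\<zeta> N \<rho> \<zeta> k = sigma (space M)
     ((\<Union>j<k. sets (vimage_algebra (space M) (\<rho> j) (R j))) \<union>
      (\<Union>j<k. \<Union>i<N j. sets (vimage_algebra (space M) (\<zeta> j i) P\<zeta>)))"

definition history_after_primal ::
  "'w measure \<Rightarrow> (nat \<Rightarrow> 'r measure) \<Rightarrow> 'z measure \<Rightarrow> (nat \<Rightarrow> nat) \<Rightarrow>
   (nat \<Rightarrow> 'w \<Rightarrow> 'r) \<Rightarrow> (nat \<Rightarrow> nat \<Rightarrow> 'w \<Rightarrow> 'z) \<Rightarrow> nat \<Rightarrow> 'w measure" where
  "history_after_primal M R P\<zeta> N \<rho> \<zeta> k = sigma (space M)
     (sets (history M R P\<zeta> N \<rho> \<zeta> k) \<union> sets (vimage_algebra (space M) (\<rho> k) (R k)))"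

text \<open>The samples are distributed according to \<open>P\<zeta>\<close>, and the samples together with everything
  that happened before they were drawn (index \<^const>\<open>None\<close>) form an independent family.\<close>

definition fresh_iid_samples ::
  "'w measure \<Rightarrow> 'z measure \<Rightarrow> 'w measure \<Rightarrow> nat \<Rightarrow> (nat \<Rightarrow> 'w \<Rightarrow> 'z) \<Rightarrow> bool" where
  "fresh_iid_samples M P\<zeta> G n z \<longleftrightarrow>
     (\<forall>i<n. z i \<in> measurable M P\<zeta> \<and> distr M P\<zeta> (z i) = P\<zeta>) \<and>
     prob_space.indep_sets M
       (\<lambda>s. case s of None \<Rightarrow> sets G | Some i \<Rightarrow> sets (vimage_algebra (space M) (z i) P\<zeta>))
       (insert None (Some ` {..<n}))"

definition dual_sample_mean ::
  "(real^'d \<Rightarrow> 'z \<Rightarrow> real^'m) \<Rightarrow> nat \<Rightarrow> real^'d \<Rightarrow> (nat \<Rightarrow> 'z) \<Rightarrow> real^'m" where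
  "dual_sample_mean C n x z = (1 / real n) *\<^sub>R (\<Sum>i<n. C x (z i))"

definition dual_update :: "real \<Rightarrow> real \<Rightarrow> real^'m \<Rightarrow> real^'m \<Rightarrow> real^'m" where
  "dual_update \<alpha> \<gamma> l Cbar =
     (if Cbar = 0 then l else l + min \<alpha> (\<gamma> / norm Cbar) *\<^sub>R Cbar)"

text \<open>All of the algorithm except for the accuracy requirement on the primal solver. The sequence
  \<open>x 0, x 1, \<dots>\<close> does not contain the initial iterate \<open>xinit\<close>, which is \<open>x\<^sub>-\<^sub>1\<close>.\<close>

definition mescal_run ::
  "'w measure \<Rightarrow> (real^'d) set \<Rightarrow> (real^'d \<Rightarrow> 'z \<Rightarrow> real^'m) \<Rightarrow> 'z measure \<Rightarrow>
   (nat \<Rightarrow> 'r measure) \<Rightarrow> (nat \<Rightarrow> real^'d \<Rightarrow> real^'m \<Rightarrow> 'r \<Rightarrow> real^'d) \<Rightarrow>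
   (nat \<Rightarrow> real) \<Rightarrow> (nat \<Rightarrow> real) \<Rightarrow> (nat \<Rightarrow> nat) \<Rightarrow> real^'d \<Rightarrow> real^'m \<Rightarrow>
   (nat \<Rightarrow> 'w \<Rightarrow> 'r) \<Rightarrow> (nat \<Rightarrow> nat \<Rightarrow> 'w \<Rightarrow> 'z) \<Rightarrow>
   (nat \<Rightarrow> 'w \<Rightarrow> real^'d) \<Rightarrow> (nat \<Rightarrow> 'w \<Rightarrow> real^'m) \<Rightarrow> bool" where
  "mescal_run M X C P\<zeta> R solver \<alpha> \<gamma> N xinit lam0 \<rho> \<zeta> x lam \<longleftrightarrow>
     (\<forall>k. \<rho> k \<in> measurable M (R k)) \<and>
     (\<forall>k. (\<lambda>(y, l, r). solver k y l r) \<in> measurable (borel \<Otimes>\<^sub>M borel \<Otimes>\<^sub>M R k) borel) \<and>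
     (\<forall>w\<in>space M. lam 0 w = lam0) \<and>
     (\<forall>k. \<forall>w\<in>space M.
        x k w = solver k (if k = 0 then xinit else x (k - 1) w) (lam k w) (\<rho> k w) \<and>
        x k w \<in> X) \<and>
     (\<forall>k. fresh_iid_samples M P\<zeta> (history_after_primal M R P\<zeta> N \<rho> \<zeta> k) (N k) (\<zeta> k)) \<and>
     (\<forall>k. \<forall>w\<in>space M. lam (Suc k) w =
        dual_update (\<alpha> k) (\<gamma> k) (lam k w) (dual_sample_mean C (N k) (x k w) (\<lambda>i. \<zeta> k i w)))"

definition option_I ::
  "'w measure \<Rightarrow> 'w measure \<Rightarrow> (real^'d) set \<Rightarrow> (real^'d \<Rightarrow> real) \<Rightarrow> (real^'d \<Rightarrow> real^'m) \<Rightarrow>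
   real \<Rightarrow> real \<Rightarrow> real \<Rightarrow> ('w \<Rightarrow> real^'d) \<Rightarrow> ('w \<Rightarrow> real^'m) \<Rightarrow> bool" where
  "option_I M G X f c \<alpha> \<epsilon>g \<epsilon>H xk lk \<longleftrightarrow>
     (AE w in M. nn_cond_exp M G
        (\<lambda>v. ennreal (subproblem_residual X f c \<alpha> (xk v) (lk v))) w \<le> ennreal \<epsilon>g) \<and>
     has_expectation M (\<lambda>v. subproblem_curv X f c \<alpha> (xk v) (lk v)) \<and>
     (AE w in M. ereal_cond_exp M G
        (\<lambda>v. subproblem_curv X f c \<alpha> (xk v) (lk v)) w \<ge> - ereal \<epsilon>H)"

definition option_II ::
  "'w measure \<Rightarrow> 'w measure \<Rightarrow> (real^'d) set \<Rightarrow> (real^'d \<Rightarrow> real) \<Rightarrow> (real^'d \<Rightarrow> real^'m) \<Rightarrow>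
   real \<Rightarrow> real \<Rightarrow> real \<Rightarrow> real \<Rightarrow> ('w \<Rightarrow> real^'d) \<Rightarrow> ('w \<Rightarrow> real^'m) \<Rightarrow> bool" where
  "option_II M G X f c \<alpha> \<epsilon>g \<epsilon>H p xk lk \<longleftrightarrow>
     (AE w in M. real_cond_exp M G
        (indicat_real {v \<in> space M. subproblem_residual X f c \<alpha> (xk v) (lk v) \<le> \<epsilon>g \<and>
           subproblem_curv X f c \<alpha> (xk v) (lk v) \<ge> - ereal \<epsilon>H}) w \<ge> p)"

definition K_star :: "real \<Rightarrow> real \<Rightarrow> real \<Rightarrow> real \<Rightarrow> real \<Rightarrow> real \<Rightarrow> real \<Rightarrow> int" where
  "K_star \<beta> \<kappa>gf \<kappa>gc \<Lambda> Creg \<alpha>0 \<epsilon> =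
     \<lceil>log \<beta> ((1 + \<kappa>gf + \<kappa>gc * \<Lambda>) / (Creg * \<alpha>0 * \<epsilon>))\<rceil>"

end

theory Submission
  imports Defs
begin

text \<open>
Write \<open>J\<close> for the Jacobian of the constraints at the iterate \<open>x\<^sub>K\<close>. The multiplier
\<open>\<lambda>\<^sub>K + \<alpha>\<^sub>K c(x\<^sub>K)\<close> is the one that the gradient of the augmented Lagrangian itself suggests:
with it, the first-order residual of the constrained problem equals the residual of the subproblem
(\<open>kkt_residual_shifted_multiplier\<close>), and the Hessians differ by the term \<open>\<alpha>\<^sub>K J\<^sup>T J\<close>, which vanishes
on the null space of \<open>J\<close> (\<open>hess_aug_lag\<close>). Hence the constrained problem has no more negative
curvature than the subproblem (\<open>subproblem_curv_le_kkt_curv\<close>). Both accuracy guarantees of the primal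
solver are therefore inherited pointwise.

What remains is feasibility. The dual steps have length at most \<open>\<gamma>\<^sub>k\<close>, so all multipliers are bounded by
\<open>\<Lambda>\<close> (\<open>mescal_run_multiplier_bound\<close>). The regularity condition, together with homogeneity and
nonexpansiveness of the projection onto the tangent cone, then gives
\<open>C\<^sub>r\<^sub>e\<^sub>g \<alpha>\<^sub>K \<parallel>c(x\<^sub>K)\<parallel> \<le> r + \<kappa>\<^sub>g\<^sub>f + \<kappa>\<^sub>g\<^sub>c \<Lambda>\<close>, where \<open>r\<close> is the residual of the subproblem
(\<open>constraint_violation_bound\<close>). As \<open>r\<close> is below 1, in the sense of the chosen option, geometric growth of
\<open>\<alpha>\<^sub>K\<close> makes the violation at most \<open>\<epsilon>\<^sup>g\<close> from the threshold \<open>K_star\<close> on, and the threshold is a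
logarithm of \<open>1 / \<epsilon>\<^sup>g\<close> (\<open>K_star_bigo\<close>).

The solver's guarantees are conditional on the history, and they are turned into unconditional ones by
integration. A conditional expectation only carries information about a measurable integrand, so this
requires that residuals and minimal curvatures are random variables, although the tangent cone depends
on the iterate in a discontinuous way. Two facts make this work: the projection onto the tangent cone is
a pointwise limit of difference quotients of the projection onto the feasible set
(\<open>closest_point_tangent_cone_limit\<close>), and the minimum over a varying compact subset of the sphere can be
tested on a countable dense subset (\<open>borel_measurable_min_curv\<close>). For the curvature, which is
extended-real valued, the integrability of the negative part is itself a consequence of the conditional
bound (\<open>ereal_expectation_ge_if_ereal_cond_exp_ge\<close>).
\<close>

section \<open>Derivatives of the augmented Lagrangian\<close>

lemma grad_eqI:
  assumes "(f has_derivative (\<lambda>h. g \<bullet> h)) (at x)"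
  shows "grad f x = g"
  by (simp add: grad_def vec_eq_iff frechet_derivative_at[OF assms, symmetric] inner_axis)

lemma has_derivative_grad:
  assumes "f differentiable (at x)"
  shows "(f has_derivative (\<lambda>h. grad f x \<bullet> h)) (at x)"
proof -
  obtain D where D: "(f has_derivative D) (at x)"
    using assms by (auto simp: differentiable_def)
  interpret bounded_linear D
    using D by (rule has_derivative_bounded_linear)
  have "D h = grad f x \<bullet> h" for h
  proof -
    have "D h = D (\<Sum>i\<in>UNIV. h $ i *\<^sub>R axis i 1)"
      by (simp add: basis_expansion[of h, unfolded scalar_mult_eq_scaleR])
    also have "\<dots> = grad f x \<bullet> h"
      by (simp add: sum scaleR grad_def frechet_derivative_at[OF D, symmetric] inner_vec_def mult.commute)
    finally show ?thesis .
  qed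
  then have "D = (\<lambda>h. grad f x \<bullet> h)" by blast
  then show ?thesis using D by simp
qed

lemma has_derivative_matrix_unique:
  fixes F :: "real^'d \<Rightarrow> real^'n"
  assumes "(F has_derivative (\<lambda>h. A *v h)) (at x)"
  shows "jacobian F (at x) = A"
  by (simp add: jacobian_def frechet_derivative_at[OF assms, symmetric])

lemma has_derivative_jacobian_components:
  fixes c :: "real^'d \<Rightarrow> real^'m"
  assumes "\<And>j. twice_cont_diff (\<lambda>y. c y $ j)"
  shows "(c has_derivative (\<lambda>h. (\<chi> j. grad (\<lambda>y. c y $ j) x) *v h)) (at x)"
proof (rule has_derivative_componentwise_within[THEN iffD2], rule ballI)
  fix i :: "real^'m" assume "i \<in> Basis"
  then obtain j where "i = axis j 1" by (auto simp: Basis_vec_def)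
  then show "((\<lambda>x. c x \<bullet> i) has_derivative
      (\<lambda>h. ((\<chi> j. grad (\<lambda>y. c y $ j) x) *v h) \<bullet> i)) (at x)"
    using has_derivative_grad[of "\<lambda>y. c y $ j" x] assms[of j]
    by (simp add: inner_axis matrix_vector_mul_component twice_cont_diff_def)
qed

lemma jacobian_eq_component_grads:
  fixes c :: "real^'d \<Rightarrow> real^'m"
  assumes "\<And>j. twice_cont_diff (\<lambda>y. c y $ j)"
  shows "jacobian c (at x) = (\<chi> j. grad (\<lambda>y. c y $ j) x)"
  by (rule has_derivative_matrix_unique has_derivative_jacobian_components assms)+

lemma has_derivative_jacobian:
  fixes c :: "real^'d \<Rightarrow> real^'m"
  assumes "\<And>j. twice_cont_diff (\<lambda>y. c y $ j)"
  shows "(c has_derivative (\<lambda>h. jacobian c (at x) *v h)) (at x)"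
  unfolding jacobian_eq_component_grads[of c, OF assms]
  by (rule has_derivative_jacobian_components assms)+

lemma transpose_jacobian_mult:
  fixes c :: "real^'d \<Rightarrow> real^'m"
  assumes "\<And>j. twice_cont_diff (\<lambda>y. c y $ j)"
  shows "transpose (jacobian c (at x)) *v l = (\<Sum>j\<in>UNIV. l $ j *\<^sub>R grad (\<lambda>y. c y $ j) x)"
  unfolding jacobian_eq_component_grads[of c, OF assms]
  by (simp add: vec_eq_iff matrix_vector_mult_def transpose_def mult.commute)

lemma grad_aug_lag:
  fixes f :: "real^'d \<Rightarrow> real" and c :: "real^'d \<Rightarrow> real^'m"
  assumes f: "twice_cont_diff f" and c: "\<And>j. twice_cont_diff (\<lambda>y. c y $ j)"
  shows "grad (\<lambda>y. aug_lag f c \<alpha> y l) x =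
    grad f x + transpose (jacobian c (at x)) *v (l + \<alpha> *\<^sub>R c x)"
proof (rule grad_eqI)
  let ?J = "jacobian c (at x)"
  have "((\<lambda>y. f y + l \<bullet> c y + \<alpha> / 2 * (c y \<bullet> c y)) has_derivative
      (\<lambda>h. grad f x \<bullet> h + l \<bullet> (?J *v h) + \<alpha> / 2 * (c x \<bullet> (?J *v h) + (?J *v h) \<bullet> c x))) (at x)"
    using f has_derivative_jacobian[of c x, OF c]
    by (intro has_derivative_add has_derivative_inner_right has_derivative_inner has_derivative_mult_right
        has_derivative_grad) (auto simp: twice_cont_diff_def)
  moreover have "(transpose ?J *v v) \<bullet> h = v \<bullet> (?J *v h)" for v h
    by (simp add: transpose_matrix_vector dot_lmul_matrix)
  ultimately show "((\<lambda>y. aug_lag f c \<alpha> y l) has_derivative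
      (\<lambda>h. (grad f x + transpose ?J *v (l + \<alpha> *\<^sub>R c x)) \<bullet> h)) (at x)"
    by (simp add: aug_lag_def power2_norm_eq_inner inner_add_left inner_commute algebra_simps)
qed

text \<open>Differentiating the multiplier \<open>l + \<alpha> *\<^sub>R c y\<close> that multiplies the constraint gradients produces the
Gauss--Newton term \<open>\<alpha> J\<^sup>T J\<close>; everything else is the Hessian of the ordinary Lagrangian at the shifted
multiplier. The quadratic form of the extra term is \<open>\<alpha> \<parallel>J u\<parallel>\<^sup>2\<close>, which vanishes on the null space of
the Jacobian.\<close>

lemma hess_aug_lag:
  fixes f :: "real^'d \<Rightarrow> real" and c :: "real^'d \<Rightarrow> real^'m"
  assumes f: "twice_cont_diff f" and c: "\<And>j. twice_cont_diff (\<lambda>y. c y $ j)"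
  shows "hess (\<lambda>y. aug_lag f c \<alpha> y l) x =
    hess f x + (\<Sum>j\<in>UNIV. (l + \<alpha> *\<^sub>R c x) $ j *\<^sub>R hess (\<lambda>y. c y $ j) x)
      + \<alpha> *\<^sub>R (transpose (jacobian c (at x)) ** jacobian c (at x))"
proof -
  let ?J = "jacobian c (at x)" and ?g = "\<lambda>j. grad (\<lambda>y. c y $ j)"
  have D: "(grad g has_derivative (\<lambda>h. hess g x *v h)) (at x)" if "twice_cont_diff g"
    for g :: "real^'d \<Rightarrow> real"
    using that jacobian_works[of "grad g" "at x"] by (simp add: twice_cont_diff_def hess_def)
  have Dc: "((\<lambda>y. c y $ j) has_derivative (\<lambda>h. ?g j x \<bullet> h)) (at x)" for j
    using c[of j] by (auto intro!: has_derivative_grad simp: twice_cont_diff_def)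
  have "((\<lambda>y. grad f y + (\<Sum>j\<in>UNIV. (l $ j + \<alpha> * c y $ j) *\<^sub>R ?g j y)) has_derivative
      (\<lambda>h. hess f x *v h + (\<Sum>j\<in>UNIV. (l $ j + \<alpha> * c x $ j) *\<^sub>R (hess (\<lambda>y. c y $ j) x *v h)
        + (\<alpha> * (?g j x \<bullet> h)) *\<^sub>R ?g j x))) (at x)"
    by (auto intro!: derivative_eq_intros D f c Dc)
  moreover have "hess f x *v h + (\<Sum>j\<in>UNIV. (l $ j + \<alpha> * c x $ j) *\<^sub>R (hess (\<lambda>y. c y $ j) x *v h)
        + (\<alpha> * (?g j x \<bullet> h)) *\<^sub>R ?g j x) =
      (hess f x + (\<Sum>j\<in>UNIV. (l + \<alpha> *\<^sub>R c x) $ j *\<^sub>R hess (\<lambda>y. c y $ j) x)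
        + \<alpha> *\<^sub>R (transpose ?J ** ?J)) *v h" for h
  proof -
    have "(\<Sum>j\<in>UNIV. (\<alpha> * (?g j x \<bullet> h)) *\<^sub>R ?g j x) = \<alpha> *\<^sub>R (transpose ?J *v (?J *v h))"
      unfolding transpose_jacobian_mult[of c, OF c]
      by (simp add: jacobian_eq_component_grads[of c, OF c] matrix_vector_mul_component scaleR_sum_right)
    moreover have "sum A UNIV *v h = (\<Sum>j\<in>UNIV. A j *v h)" for A :: "'m \<Rightarrow> real^'d^'d"
      by (induction rule: finite_induct[OF finite_class.finite_UNIV]) (auto simp: matrix_vector_mult_add_rdistrib)
    ultimately show ?thesis
      by (simp add: matrix_vector_mult_add_rdistrib scaleR_matrix_vector_assoc[symmetric]
          matrix_vector_mul_assoc[symmetric] sum.distrib)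
  qed
  ultimately have "((\<lambda>y. grad (\<lambda>y. aug_lag f c \<alpha> y l) y) has_derivative
      (\<lambda>h. (hess f x + (\<Sum>j\<in>UNIV. (l + \<alpha> *\<^sub>R c x) $ j *\<^sub>R hess (\<lambda>y. c y $ j) x)
        + \<alpha> *\<^sub>R (transpose ?J ** ?J)) *v h)) (at x)"
    by (simp add: grad_aug_lag[OF f c] transpose_jacobian_mult[of c, OF c] del: transpose_matrix_vector)
  then show ?thesis
    unfolding hess_def by (intro has_derivative_matrix_unique) auto
qed

text \<open>The shift \<open>\<alpha> *\<^sub>R c x\<close> is chosen so that it absorbs the gradient \<open>\<alpha> J\<^sup>T c(x)\<close> of the penalty term:
stationarity for the subproblem is literally first-order stationarity for the constrained problem.\<close>

lemma kkt_residual_shifted_multiplier: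
  assumes "twice_cont_diff f" and "\<And>j. twice_cont_diff (\<lambda>y. c y $ j)"
  shows "kkt_residual X f c x (l + \<alpha> *\<^sub>R c x) = subproblem_residual X f c \<alpha> x l"
  by (simp add: kkt_residual_def subproblem_residual_def grad_aug_lag[OF assms] algebra_simps)

text \<open>Passing to the null space of the Jacobian only removes directions from the infimum, and on those that
remain the Gauss--Newton term contributes nothing.\<close>

lemma subproblem_curv_le_kkt_curv:
  assumes "twice_cont_diff f" and "\<And>j. twice_cont_diff (\<lambda>y. c y $ j)"
  shows "subproblem_curv X f c \<alpha> x l \<le> kkt_curv X f c x (l + \<alpha> *\<^sub>R c x)"
  unfolding subproblem_curv_def kkt_curv_def min_curv_def
proof (rule INF_mono)
  fix u assume u: "u \<in> {u \<in> tangent_cone_null X c x. norm u = 1}"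
  then have Ju: "jacobian c (at x) *v u = 0" and T: "u \<in> tangent_cone X x"
    by (auto simp: tangent_cone_null_def)
  have "hess (\<lambda>y. aug_lag f c \<alpha> y l) x *v u =
      (hess f x + (\<Sum>j\<in>UNIV. (l + \<alpha> *\<^sub>R c x) $ j *\<^sub>R hess (\<lambda>y. c y $ j) x)) *v u"
    unfolding hess_aug_lag[OF assms] matrix_vector_mult_add_rdistrib[of _ _ u]
    by (simp add: scaleR_matrix_vector_assoc[symmetric] matrix_vector_mul_assoc[symmetric] Ju)
  then show "\<exists>v\<in>{u \<in> tangent_cone X x. norm u = 1}.
      ereal (v \<bullet> (hess (\<lambda>y. aug_lag f c \<alpha> y l) x *v v)) \<le>
      ereal (u \<bullet> ((hess f x + (\<Sum>j\<in>UNIV. (l + \<alpha> *\<^sub>R c x) $ j *\<^sub>R hess (\<lambda>y. c y $ j) x)) *v u))"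
    using u T by (intro bexI[of _ u]) auto
qed

section \<open>The tangent cone of a convex set\<close>

text \<open>A convex set contains, with \<open>y\<close>, the whole segment from \<open>x\<close> to \<open>y\<close>, so that a direction
\<open>s *\<^sub>R (y - x)\<close> can be realised by points of the set arbitrarily close to \<open>x\<close>. The sequences in the
definition of the tangent cone are thereby reduced to a closure, from which closedness, convexity and
invariance under scaling can be read off.\<close>

lemma tangent_cone_eq_closure:
  fixes X :: "(real^'d) set"
  assumes "convex X" and x: "x \<in> X"
  shows "tangent_cone X x = closure {s *\<^sub>R (y - x) | s y. 0 \<le> s \<and> y \<in> X}"
    (is "_ = closure ?D")
proof
  show "tangent_cone X x \<subseteq> closure ?D"
  proof
    fix v assume "v \<in> tangent_cone X x"
    then obtain y t where yt: "\<And>n::nat. y n \<in> X \<and> 0 < t n"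
      and v: "(\<lambda>n. (y n - x) /\<^sub>R t n) \<longlonglongrightarrow> v"
      unfolding tangent_cone_def by blast
    have "(y n - x) /\<^sub>R t n \<in> ?D" for n
      using yt[of n] by (auto intro!: exI[of _ "inverse (t n)"] exI[of _ "y n"])
    with v show "v \<in> closure ?D"
      unfolding closure_sequential by (intro exI[of _ "\<lambda>n. (y n - x) /\<^sub>R t n"] conjI allI)
  qed
  show "closure ?D \<subseteq> tangent_cone X x"
  proof
    fix v assume "v \<in> closure ?D"
    then obtain d where d: "\<And>n. d n \<in> ?D" "d \<longlonglongrightarrow> v"
      unfolding closure_sequential by blast
    have "\<forall>n. \<exists>s z. 0 \<le> s \<and> z \<in> X \<and> d n = s *\<^sub>R (z - x)"
      using d(1) by blast
    then obtain s z where sz: "\<And>n. 0 \<le> s n" "\<And>n. z n \<in> X" "\<And>n. d n = s n *\<^sub>R (z n - x)"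
      by metis
    \<comment> \<open>The three factors make \<open>t n * s n\<close> at most 1, so that \<open>y n\<close> lies on the segment from \<open>x\<close>
      to \<open>z n\<close>, and make both \<open>t n\<close> and \<open>y n - x\<close> tend to 0 although \<open>s\<close> and \<open>z\<close> may be
      unbounded.\<close>
    define t where "t n = 1 / ((1 + s n) * (1 + norm (z n - x)) * (real n + 1))" for n
    define y where "y n = x + (t n * s n) *\<^sub>R (z n - x)" for n
    have den: "1 + s n \<ge> 1" "1 + norm (z n - x) \<ge> 1" "real n + 1 \<ge> 1" for n
      using sz(1)[of n] by auto
    have nz: "1 + s n \<noteq> 0" "1 + norm (z n - x) \<noteq> 0" for n
      using den(1)[of n] den(2)[of n] by linarith+
    have tpos: "0 < t n" for n
      unfolding t_def using den[of n] by (intro divide_pos_pos mult_pos_pos) linarith+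
    have ts: "t n * s n * (1 + norm (z n - x)) * (real n + 1) \<le> 1" for n
    proof -
      have "t n * s n * (1 + norm (z n - x)) * (real n + 1) = s n / (1 + s n)"
        unfolding t_def using nz(1)[of n] nz(2)[of n] by (simp add: divide_simps)
      also have "\<dots> \<le> 1" using sz(1)[of n] by (simp add: divide_simps)
      finally show ?thesis .
    qed
    have small: "t n * s n \<le> 1" "t n * s n * norm (z n - x) \<le> 1 / (real n + 1)" for n
    proof -
      have p: "0 \<le> t n * s n" using tpos[of n] sz(1)[of n] by simp
      have "t n * s n * 1 \<le> t n * s n * ((1 + norm (z n - x)) * (real n + 1))"
        using p mult_mono[OF den(2,3)[of n]] by (intro mult_left_mono) auto
      with ts[of n] show "t n * s n \<le> 1" by (simp only: mult.assoc mult_1_right)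
      have "t n * s n * norm (z n - x) * (real n + 1) \<le> t n * s n * (1 + norm (z n - x)) * (real n + 1)"
        using p by (intro mult_right_mono mult_left_mono) auto
      with ts[of n] show "t n * s n * norm (z n - x) \<le> 1 / (real n + 1)"
        by (simp add: pos_le_divide_eq)
    qed
    have yX: "y n \<in> X" for n
    proof -
      have "y n = (1 - t n * s n) *\<^sub>R x + (t n * s n) *\<^sub>R z n"
        by (simp add: y_def algebra_simps)
      moreover have "(1 - t n * s n) *\<^sub>R x + (t n * s n) *\<^sub>R z n \<in> X"
        using small(1)[of n] less_imp_le[OF tpos, of n] sz(1)[of n]
        by (intro convexD assms(1) x sz(2)) simp_all
      ultimately show ?thesis by simp
    qed
    have inv0: "(\<lambda>n. 1 / (real n + 1)) \<longlonglongrightarrow> 0"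
      using LIMSEQ_inverse_real_of_nat by (simp add: divide_inverse add.commute)
    have "(\<lambda>n. y n - x) \<longlonglongrightarrow> 0"
    proof (rule Lim_null_comparison[OF always_eventually inv0], rule allI)
      show "norm (y n - x) \<le> 1 / (real n + 1)" for n
        using small(2)[of n] less_imp_le[OF tpos, of n] sz(1)[of n]
        by (simp only: y_def add_diff_cancel_left' norm_scaleR abs_mult abs_of_nonneg)
    qed
    then have ylim: "y \<longlonglongrightarrow> x"
      by (rule LIM_zero_cancel)
    have "t \<longlonglongrightarrow> 0"
    proof (rule Lim_null_comparison[OF always_eventually inv0], rule allI)
      fix n
      have "1 \<le> (1 + s n) * (1 + norm (z n - x))"
        using mult_mono[OF den(1,2)[of n]] sz(1)[of n] by simp
      then have "1 / ((1 + s n) * (1 + norm (z n - x))) / (real n + 1) \<le> 1 / (real n + 1)"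
        by (intro divide_right_mono) simp_all
      then show "norm (t n) \<le> 1 / (real n + 1)"
        unfolding real_norm_def abs_of_pos[OF tpos] by (simp add: t_def)
    qed
    moreover have "(y n - x) /\<^sub>R t n = d n" for n
    proof -
      have "t n \<noteq> 0" using tpos[of n] by simp
      then show ?thesis by (simp add: y_def sz(3))
    qed
    ultimately show "v \<in> tangent_cone X x"
      unfolding tangent_cone_def using yX tpos ylim d(2)
      by (intro CollectI exI[of _ y] exI[of _ t] conjI allI) simp_all
  qed
qed

lemma
  fixes X :: "(real^'d) set"
  assumes "convex X" and x: "x \<in> X"
  shows closed_tangent_cone: "closed (tangent_cone X x)"
    and convex_tangent_cone: "convex (tangent_cone X x)"
    and zero_in_tangent_cone: "0 \<in> tangent_cone X x"
    and tangent_cone_scaleR: "v \<in> tangent_cone X x \<Longrightarrow> 0 \<le> a \<Longrightarrow> a *\<^sub>R v \<in> tangent_cone X x"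
    and diff_in_tangent_cone: "y \<in> X \<Longrightarrow> 0 \<le> s \<Longrightarrow> s *\<^sub>R (y - x) \<in> tangent_cone X x"
proof -
  let ?D = "{s *\<^sub>R (y - x) | s y. 0 \<le> s \<and> y \<in> X}"
  note T = tangent_cone_eq_closure[OF assms]
  have D_eq: "?D = cone hull ((\<lambda>y. y - x) ` X)"
    by (auto simp: cone_hull_expl)
  have "convex ((\<lambda>y. y - x) ` X)"
    using convex_translation[OF assms(1), of "- x"] by simp
  then have "convex ?D"
    unfolding D_eq by (rule convex_cone_hull)
  then show "convex (tangent_cone X x)"
    unfolding T by (rule convex_closure)
  show "closed (tangent_cone X x)"
    unfolding T by simp
  show "0 \<in> tangent_cone X x"
    unfolding T using x by (intro closure_subset[THEN subsetD]) auto
  have "cone (closure ?D)"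
    unfolding D_eq by (intro cone_closure cone_cone_hull)
  then show "v \<in> tangent_cone X x \<Longrightarrow> 0 \<le> a \<Longrightarrow> a *\<^sub>R v \<in> tangent_cone X x"
    unfolding T cone_def by blast
  show "y \<in> X \<Longrightarrow> 0 \<le> s \<Longrightarrow> s *\<^sub>R (y - x) \<in> tangent_cone X x"
    unfolding T by (intro closure_subset[THEN subsetD]) auto
qed

lemma closest_point_cone_scaleR:
  fixes T :: "'a::euclidean_space set"
  assumes "convex T" "closed T" "0 \<in> T" and cone: "\<And>v s. v \<in> T \<Longrightarrow> 0 \<le> s \<Longrightarrow> s *\<^sub>R v \<in> T"
    and a: "0 < a"
  shows "closest_point T (a *\<^sub>R v) = a *\<^sub>R closest_point T v"
proof (rule closest_point_unique[symmetric])
  show "a *\<^sub>R closest_point T v \<in> T"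
    using assms by (intro cone closest_point_in_set) auto
  show "\<forall>z\<in>T. dist (a *\<^sub>R v) (a *\<^sub>R closest_point T v) \<le> dist (a *\<^sub>R v) z"
  proof
    fix z assume "z \<in> T"
    then have "dist v (closest_point T v) \<le> dist v (inverse a *\<^sub>R z)"
      using a by (intro closest_point_le assms) auto
    then have "a * dist v (closest_point T v) \<le> a * dist v (inverse a *\<^sub>R z)"
      using a by (intro mult_left_mono) auto
    moreover have "a * dist u w = dist (a *\<^sub>R u) (a *\<^sub>R w)" for u w :: 'a
      using a by (simp add: dist_norm scaleR_diff_right[symmetric])
    ultimately show "dist (a *\<^sub>R v) (a *\<^sub>R closest_point T v) \<le> dist (a *\<^sub>R v) z"
      using a by simp
  qed
qed (use assms in auto)

text \<open>The angle at the projection between \<open>v\<close> and a point of the convex set is at least a right one.\<close>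

lemma closest_point_pythagoras:
  fixes T :: "'a::euclidean_space set"
  assumes "convex T" "closed T" "z \<in> T"
  shows "(norm (z - closest_point T v))\<^sup>2 \<le> (dist v z)\<^sup>2 - (dist v (closest_point T v))\<^sup>2"
proof -
  let ?p = "closest_point T v"
  have "(v - ?p) \<bullet> (z - ?p) \<le> 0"
    using assms by (rule closest_point_dot)
  moreover have "(norm (v - z))\<^sup>2 = (norm (v - ?p))\<^sup>2 + (norm (z - ?p))\<^sup>2 - 2 * ((v - ?p) \<bullet> (z - ?p))"
  proof -
    have "(norm (a - b))\<^sup>2 = (norm a)\<^sup>2 + (norm b)\<^sup>2 - 2 * (a \<bullet> b)" for a b :: 'a
      by (simp add: power2_norm_eq_inner inner_diff_left inner_diff_right inner_commute)
    from this[of "v - ?p" "z - ?p"] show ?thesis by (simp only: diff_diff_eq2 diff_add_cancel)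
  qed
  ultimately show ?thesis
    unfolding dist_norm by linarith
qed

text \<open>The tangent-cone projection is a directional derivative of the projection onto \<open>X\<close>. With
\<open>a = real (Suc n)\<close>, the \<open>n\<close>-th term is the projection of \<open>v\<close> onto the blown-up set
\<open>{a *\<^sub>R (y - x) | y. y \<in> X}\<close>. These sets lie in the tangent cone, increase with \<open>n\<close> and have a dense
union, so the distances from \<open>v\<close> converge to the distance from the cone, and
\<open>closest_point_pythagoras\<close> turns convergence of distances into convergence of the nearest points.
The terms are continuous in \<open>(x, v)\<close>, which makes the projection onto the tangent cone a Borel
function of both.\<close>

lemma closest_point_tangent_cone_limit:
  fixes X :: "(real^'d) set"
  assumes X: "convex X" "closed X" and x: "x \<in> X"
  shows "(\<lambda>n. real (Suc n) *\<^sub>R (closest_point X (x + v /\<^sub>R real (Suc n)) - x))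
    \<longlonglongrightarrow> closest_point (tangent_cone X x) v"
proof -
  let ?T = "tangent_cone X x" and ?p = "closest_point (tangent_cone X x) v"
  define d where "d n = real (Suc n) *\<^sub>R (closest_point X (x + v /\<^sub>R real (Suc n)) - x)" for n
  have dT: "d n \<in> ?T" for n
    unfolding d_def using x by (intro diff_in_tangent_cone closest_point_in_set X) auto
  have pT: "?p \<in> ?T"
    using zero_in_tangent_cone[OF X(1) x] by (intro closest_point_in_set closed_tangent_cone X x) auto
  have d_min: "dist v (d n) \<le> dist v (real (Suc n) *\<^sub>R (y - x))" if "y \<in> X" for n y
  proof -
    let ?a = "real (Suc n)"
    have scale: "dist v (a *\<^sub>R (y - x)) = a * dist (x + v /\<^sub>R a) y" if "0 < a" for a y
    proof -
      have "v - a *\<^sub>R (y - x) = a *\<^sub>R ((x + v /\<^sub>R a) - y)"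
        using that by (simp add: algebra_simps)
      then show ?thesis unfolding dist_norm using that by simp
    qed
    show ?thesis
      unfolding d_def scale[of ?a, OF of_nat_0_less_iff[THEN iffD2, OF zero_less_Suc]] using closest_point_le[OF X(2) that] by (intro mult_left_mono) auto
  qed
  have "(\<lambda>n. dist v (d n)) \<longlonglongrightarrow> dist v ?p"
  proof (rule LIMSEQ_I)
    fix e :: real assume e: "0 < e"
    \<comment> \<open>A point \<open>q\<close> of the cone that is nearly optimal belongs to the blown-up sets from
      \<open>real (Suc n) \<ge> s\<close> on.\<close>
    from pT obtain q where q: "q \<in> {s *\<^sub>R (y - x) | s y. 0 \<le> s \<and> y \<in> X}" "dist q ?p < e"
      unfolding tangent_cone_eq_closure[OF X(1) x] closure_approachable using e by blast
    then obtain s y where sy: "q = s *\<^sub>R (y - x)" "0 \<le> s" "y \<in> X" by blast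
    show "\<exists>n0. \<forall>n\<ge>n0. norm (dist v (d n) - dist v ?p) < e"
    proof (intro exI allI impI)
      fix n assume n: "nat \<lceil>s\<rceil> \<le> n"
      let ?a = "real (Suc n)"
      have "s \<le> ?a" using n by linarith
      then have r: "0 \<le> s / ?a" "s / ?a \<le> 1" using sy(2) by auto
      have "(1 - s / ?a) *\<^sub>R x + (s / ?a) *\<^sub>R y \<in> X"
        using r by (intro convexD X x sy) auto
      then have "dist v (d n) \<le> dist v (?a *\<^sub>R ((1 - s / ?a) *\<^sub>R x + (s / ?a) *\<^sub>R y - x))"
        by (rule d_min)
      also have "(1 - s / ?a) *\<^sub>R x + (s / ?a) *\<^sub>R y - x = (s / ?a) *\<^sub>R (y - x)"
        by (simp add: algebra_simps)
      also have "?a *\<^sub>R (s / ?a) *\<^sub>R (y - x) = q"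
        unfolding sy(1) by (simp del: of_nat_Suc)
      also have "dist v q \<le> dist v ?p + dist q ?p"
        by (metis dist_triangle dist_commute)
      finally have "dist v (d n) < dist v ?p + e" using q(2) by simp
      moreover have "dist v ?p \<le> dist v (d n)"
        by (intro closest_point_le closed_tangent_cone X x dT)
      ultimately show "norm (dist v (d n) - dist v ?p) < e" by simp
    qed
  qed
  then have "(\<lambda>n. sqrt ((dist v (d n))\<^sup>2 - (dist v ?p)\<^sup>2)) \<longlonglongrightarrow> sqrt ((dist v ?p)\<^sup>2 - (dist v ?p)\<^sup>2)"
    by (intro tendsto_real_sqrt tendsto_diff tendsto_power tendsto_const)
  then have lim0: "(\<lambda>n. sqrt ((dist v (d n))\<^sup>2 - (dist v ?p)\<^sup>2)) \<longlonglongrightarrow> 0" by simp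
  have "(\<lambda>n. d n - ?p) \<longlonglongrightarrow> 0"
  proof (rule Lim_null_comparison[OF always_eventually lim0], rule allI)
    show "norm (d n - ?p) \<le> sqrt ((dist v (d n))\<^sup>2 - (dist v ?p)\<^sup>2)" for n
      using closest_point_pythagoras[OF convex_tangent_cone[OF X(1) x] closed_tangent_cone[OF X(1) x] dT[of n], of v]
      by (rule real_le_rsqrt)
  qed
  then show ?thesis
    unfolding d_def[symmetric] by (rule LIM_zero_cancel)
qed

text \<open>The negative gradient of the augmented Lagrangian is \<open>- \<alpha> J\<^sup>T c(x)\<close> up to the bounded perturbation
\<open>\<nabla>f + J\<^sup>T l\<close>. The projection onto a closed convex cone is positively homogeneous and nonexpansive, so
the regularity condition, scaled by \<open>\<alpha>\<close>, survives up to the size of this perturbation.\<close>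

lemma constraint_violation_bound:
  fixes X :: "(real^'d) set"
  assumes f: "twice_cont_diff f" and c: "\<And>j. twice_cont_diff (\<lambda>y. c y $ j)"
    and X: "convex X" and x: "x \<in> X" and \<alpha>: "0 < \<alpha>"
    and kf: "norm (grad f x) \<le> \<kappa>f" and kc: "onorm ((*v) (jacobian c (at x))) \<le> \<kappa>c"
    and l: "norm l \<le> \<Lambda>"
    and reg: "Creg * norm (c x) \<le>
      norm (closest_point (tangent_cone X x) (- (transpose (jacobian c (at x)) *v c x)))"
  shows "Creg * \<alpha> * norm (c x) \<le> subproblem_residual X f c \<alpha> x l + (\<kappa>f + \<kappa>c * \<Lambda>)"
proof -
  let ?J = "jacobian c (at x)" and ?P = "closest_point (tangent_cone X x)"
  let ?a = "\<alpha> *\<^sub>R (- (transpose ?J *v c x))" and ?b = "- grad (\<lambda>y. aug_lag f c \<alpha> y l) x"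
  note T = convex_tangent_cone[OF X x] closed_tangent_cone[OF X x]
  have bl: "bounded_linear ((*v) ?J)"
    by (simp add: matrix_vector_mul_bounded_linear)
  have Jt: "norm (transpose ?J *v l) \<le> \<kappa>c * \<Lambda>"
  proof -
    let ?w = "transpose ?J *v l"
    have "norm ?w * norm ?w = l \<bullet> (?J *v ?w)"
      by (simp add: dot_lmul_matrix[symmetric] power2_norm_eq_inner flip: power2_eq_square)
    also have "\<dots> \<le> norm l * (onorm ((*v) ?J) * norm ?w)"
      using norm_cauchy_schwarz[of l "?J *v ?w"] onorm[OF bl, of ?w]
      by (meson mult_left_mono norm_ge_zero order_trans)
    finally have "norm ?w * norm ?w \<le> (onorm ((*v) ?J) * norm l) * norm ?w" by (simp add: mult_ac)
    then have "norm ?w \<le> onorm ((*v) ?J) * norm l"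
      using onorm_pos_le[OF bl] by (cases "norm ?w = 0") auto
    also have "\<dots> \<le> \<kappa>c * \<Lambda>"
      using kc l onorm_pos_le[OF bl] by (intro mult_mono) auto
    finally show ?thesis .
  qed
  have "Creg * \<alpha> * norm (c x) \<le> \<alpha> * norm (?P (- (transpose ?J *v c x)))"
    using mult_left_mono[OF reg, of \<alpha>] \<alpha> by (simp add: mult_ac)
  also have "\<dots> = norm (?P ?a)"
    using \<alpha> by (subst closest_point_cone_scaleR[OF T zero_in_tangent_cone[OF X x] tangent_cone_scaleR[OF X x]]) auto
  also have "\<dots> \<le> norm (?P ?b) + dist (?P ?a) (?P ?b)"
    by norm
  also have "\<dots> \<le> norm (?P ?b) + dist ?a ?b"
    using zero_in_tangent_cone[OF X x] by (intro add_left_mono closest_point_lipschitz T) auto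
  also have "dist ?a ?b = norm (grad f x + transpose ?J *v l)"
    unfolding dist_norm grad_aug_lag[OF f c]
    by (simp add: matrix_vector_right_distrib matrix_vector_mult_scaleR add.commute del: transpose_matrix_vector)
  also have "\<dots> \<le> \<kappa>f + \<kappa>c * \<Lambda>"
    using kf Jt by (intro norm_triangle_le) simp
  finally show ?thesis
    by (simp add: subproblem_residual_def)
qed

section \<open>Measurability of the stationarity measures\<close>

lemma borel_measurable_closest_point_tangent_cone:
  fixes X :: "(real^'d) set"
  assumes X: "convex X" "closed X"
    and x: "x \<in> borel_measurable M" "\<And>w. w \<in> space M \<Longrightarrow> x w \<in> X"
    and v: "v \<in> borel_measurable M"
  shows "(\<lambda>w. closest_point (tangent_cone X (x w)) (v w)) \<in> borel_measurable M"
proof (cases "X = {}")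
  case True
  then have "space M = {}" using x(2) by auto
  then show ?thesis by (intro measurableI) auto
next
  case False
  have [measurable]: "closest_point X \<in> borel_measurable borel"
    using continuous_on_closest_point[OF X False] by (rule borel_measurable_continuous_onI)
  note [measurable] = x(1) v
  show ?thesis
  proof (rule borel_measurable_LIMSEQ_metric)
    fix n
    show "(\<lambda>w. real (Suc n) *\<^sub>R (closest_point X (x w + v w /\<^sub>R real (Suc n)) - x w))
        \<in> borel_measurable M"
      by measurable
  next
    fix w assume "w \<in> space M"
    then show "(\<lambda>n. real (Suc n) *\<^sub>R (closest_point X (x w + v w /\<^sub>R real (Suc n)) - x w))
        \<longlonglongrightarrow> closest_point (tangent_cone X (x w)) (v w)"
      by (intro closest_point_tangent_cone_limit X x(2))
  qed
qed

text \<open>The infimum is over a compact set and therefore attained as soon as it is not \<open>\<infinity>\<close>.\<close>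

lemma min_curv_le_iff:
  fixes T :: "(real^'d) set"
  assumes "closed T"
  shows "min_curv T H \<le> ereal a \<longleftrightarrow> (\<exists>u\<in>T. norm u = 1 \<and> u \<bullet> (H *v u) \<le> a)"
proof
  let ?K = "T \<inter> sphere 0 1"
  assume le: "min_curv T H \<le> ereal a"
  have eq: "min_curv T H = (INF u\<in>?K. ereal (u \<bullet> (H *v u)))"
    unfolding min_curv_def by (intro arg_cong[where f = Inf] image_cong) (auto simp: dist_norm)
  have "?K \<noteq> {}"
    using le unfolding eq by (auto simp: top_ereal_def)
  moreover have "compact ?K"
    using assms by (intro closed_Int_compact compact_sphere)
  moreover have "continuous_on ?K (\<lambda>u. u \<bullet> (H *v u))"
    by (intro continuous_intros matrix_vector_mult_linear_continuous_on)
  ultimately obtain u where u: "u \<in> ?K" "\<And>v. v \<in> ?K \<Longrightarrow> u \<bullet> (H *v u) \<le> v \<bullet> (H *v v)"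
    using continuous_attains_inf[of ?K] by blast
  then have "ereal (u \<bullet> (H *v u)) \<le> min_curv T H"
    unfolding eq by (intro INF_greatest) auto
  then have "u \<bullet> (H *v u) \<le> a"
    using le by (metis ereal_less_eq(3) order_trans)
  then show "\<exists>u\<in>T. norm u = 1 \<and> u \<bullet> (H *v u) \<le> a"
    using u(1) by auto
next
  assume "\<exists>u\<in>T. norm u = 1 \<and> u \<bullet> (H *v u) \<le> a"
  then show "min_curv T H \<le> ereal a"
    unfolding min_curv_def by (auto intro!: INF_lower2)
qed

text \<open>Compactness allows an existential quantifier over the sphere to be replaced by countably many
conditions, at the price of \<open>= 0\<close> becoming an approximate statement. For a function that depends
measurably on a further parameter the right-hand side is visibly measurable.\<close>

lemma exists_zero_on_sphere_iff:
  fixes \<phi> :: "real^'d \<Rightarrow> real"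
  assumes cont: "continuous_on UNIV \<phi>" and nonneg: "\<And>u. 0 \<le> \<phi> u"
    and D: "D \<subseteq> sphere 0 1" "sphere 0 1 \<subseteq> closure D"
  shows "(\<exists>u\<in>sphere 0 1. \<phi> u = 0) \<longleftrightarrow> (\<forall>n. \<exists>u\<in>D. \<phi> u < 1 / real (Suc n))"
proof
  assume "\<exists>u\<in>sphere 0 1. \<phi> u = 0"
  then obtain u where u: "u \<in> closure D" "\<phi> u = 0" using D by blast
  then obtain s where s: "\<And>n. s n \<in> D" "s \<longlonglongrightarrow> u"
    unfolding closure_sequential by blast
  have "(\<lambda>n. \<phi> (s n)) \<longlonglongrightarrow> 0"
    using continuous_on_tendsto_compose[OF cont s(2)] u(2) by simp
  then have ev: "\<forall>\<^sub>F k in sequentially. \<phi> (s k) < 1 / real (Suc n)" for n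
    by (rule order_tendstoD) simp
  show "\<forall>n. \<exists>u\<in>D. \<phi> u < 1 / real (Suc n)"
  proof
    fix n
    obtain k where "\<phi> (s k) < 1 / real (Suc n)"
      using eventually_happens'[OF sequentially_bot ev[of n]] by blast
    then show "\<exists>u\<in>D. \<phi> u < 1 / real (Suc n)"
      using s(1) by blast
  qed
next
  assume R: "\<forall>n. \<exists>u\<in>D. \<phi> u < 1 / real (Suc n)"
  then have "sphere (0 :: real^'d) 1 \<noteq> {}"
    using D(1) by blast
  then obtain u where u: "u \<in> sphere 0 1" "\<forall>v\<in>sphere 0 1. \<phi> u \<le> \<phi> v"
    using continuous_attains_inf[OF compact_sphere _ continuous_on_subset[OF cont subset_UNIV]] by metis
  have "\<phi> u \<le> 0"
  proof (rule ccontr)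
    assume "\<not> \<phi> u \<le> 0"
    then obtain n where n: "1 / real (Suc n) < \<phi> u"
      using nat_approx_posE[of "\<phi> u"] by (auto simp: not_le)
    obtain v where v: "v \<in> D" "\<phi> v < 1 / real (Suc n)"
      using R by blast
    then have "\<phi> u \<le> \<phi> v"
      using u(2) D(1) by blast
    with n v(2) show False by linarith
  qed
  with nonneg[of u] u(1) show "\<exists>u\<in>sphere 0 1. \<phi> u = 0"
    by (intro bexI[of _ u]) auto
qed

text \<open>The set over which the infimum is taken varies with the point. Its membership condition and the
condition that the quadratic form is at most \<open>a\<close> are encoded in a single nonnegative function
\<open>\<phi> a w u\<close> that is continuous in \<open>u\<close> and measurable in \<open>w\<close>, where the projection onto the
tangent cone expresses membership in the cone. A sublevel set of the minimal curvature is then the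
set of \<open>w\<close> for which \<open>\<phi> a w\<close> has a zero on the sphere.\<close>

lemma borel_measurable_min_curv:
  fixes X :: "(real^'d) set" and A :: "'w \<Rightarrow> real^'d^'m"
  assumes X: "convex X" "closed X"
    and x: "x \<in> borel_measurable M" "\<And>w. w \<in> space M \<Longrightarrow> x w \<in> X"
    and A: "\<And>u. (\<lambda>w. A w *v u) \<in> borel_measurable M"
    and H: "\<And>u. (\<lambda>w. H w *v u) \<in> borel_measurable M"
  shows "(\<lambda>w. min_curv (tangent_cone X (x w) \<inter> {u. A w *v u = 0}) (H w)) \<in> borel_measurable M"
    (is "?Y \<in> _")
proof -
  let ?P = "\<lambda>w. closest_point (tangent_cone X (x w))"
  obtain D :: "(real^'d) set" where D: "countable D" "D \<subseteq> sphere 0 1" "sphere 0 1 \<subseteq> closure D"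
    using separable[of "sphere 0 1 :: (real^'d) set"] by blast
  define \<phi> where "\<phi> a w u = norm (u - ?P w u) + norm (A w *v u) + max 0 (u \<bullet> (H w *v u) - a)"
    for a w u
  have [measurable]: "(\<lambda>w. \<phi> a w u) \<in> borel_measurable M" for a u
  proof -
    note [measurable] = A H borel_measurable_closest_point_tangent_cone[OF X x borel_measurable_const[of u]]
    show ?thesis unfolding \<phi>_def by measurable
  qed
  have iff: "?Y w \<le> ereal a \<longleftrightarrow> (\<forall>n. \<exists>u\<in>D. \<phi> a w u < 1 / real (Suc n))" if w: "w \<in> space M" for w a
  proof -
    let ?T = "tangent_cone X (x w)"
    note T = closed_tangent_cone[OF X(1) x(2)[OF w]] convex_tangent_cone[OF X(1) x(2)[OF w]]
    have ne: "?T \<noteq> {}" using zero_in_tangent_cone[OF X(1) x(2)[OF w]] by auto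
    have zero: "\<phi> a w u = 0 \<longleftrightarrow> u \<in> ?T \<and> A w *v u = 0 \<and> u \<bullet> (H w *v u) \<le> a" for u
    proof -
      have "\<phi> a w u = 0 \<longleftrightarrow> norm (u - ?P w u) = 0 \<and> norm (A w *v u) = 0 \<and> max 0 (u \<bullet> (H w *v u) - a) = 0"
        unfolding \<phi>_def by (smt (verit) norm_ge_zero)
      also have "norm (u - ?P w u) = 0 \<longleftrightarrow> u \<in> ?T"
        using closest_point_refl[OF T(1) ne, of u] by auto
      also have "max 0 (u \<bullet> (H w *v u) - a) = 0 \<longleftrightarrow> u \<bullet> (H w *v u) \<le> a" by auto
      finally show ?thesis by simp
    qed
    have "closed {u. A w *v u = 0}"
      by (intro closed_Collect_eq continuous_intros matrix_vector_mult_linear_continuous_on)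
    then have "?Y w \<le> ereal a \<longleftrightarrow> (\<exists>u\<in>sphere 0 1. \<phi> a w u = 0)"
      using T(1) by (subst min_curv_le_iff) (auto simp: zero dist_norm)
    also have "\<dots> \<longleftrightarrow> (\<forall>n. \<exists>u\<in>D. \<phi> a w u < 1 / real (Suc n))"
    proof (rule exists_zero_on_sphere_iff[OF _ _ D(2,3)])
      show "continuous_on UNIV (\<phi> a w)"
        unfolding \<phi>_def by (intro continuous_intros continuous_on_closest_point T ne
            matrix_vector_mult_linear_continuous_on continuous_on_max)
      show "0 \<le> \<phi> a w u" for u
        unfolding \<phi>_def by auto
    qed
    finally show ?thesis .
  qed
  have le: "{w \<in> space M. ?Y w \<le> ereal a} \<in> sets M" for a
  proof -
    have "{w \<in> space M. ?Y w \<le> ereal a} = {w \<in> space M. \<forall>n. \<exists>u\<in>D. \<phi> a w u < 1 / real (Suc n)}"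
      using iff by auto
    also have "\<dots> \<in> sets M"
      using D(1) by measurable
    finally show ?thesis .
  qed
  show ?thesis
    unfolding borel_measurable_iff_Iic_ereal
  proof
    fix a :: ereal
    have eq: "?Y -` {..a} \<inter> space M = {w \<in> space M. ?Y w \<le> a}" by auto
    show "?Y -` {..a} \<inter> space M \<in> sets M"
    proof (cases a)
      case (real r)
      then show ?thesis unfolding eq by (simp add: le)
    next
      case PInf
      then show ?thesis unfolding eq by simp
    next
      case MInf
      have "{w \<in> space M. ?Y w \<le> a} = (\<Inter>n::nat. {w \<in> space M. ?Y w \<le> ereal (- real n)})"
      proof -
        have "y \<le> - \<infinity>" if "\<And>n::nat. y \<le> ereal (- real n)" for y
        proof (cases y)
          case (real r)
          obtain n :: nat where "- r < real n" using reals_Archimedean2 by blast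
          then show ?thesis using that[of n] real by simp
        next
          case PInf
          then show ?thesis using that[of 0] by simp
        qed simp
        then show ?thesis unfolding MInf by (auto simp: bot_ereal_def intro: order_trans)
      qed
      also have "\<dots> \<in> sets M" using le by (intro sets.countable_INT) auto
      finally show ?thesis unfolding eq .
    qed
  qed
qed

lemma continuous_on_twice_cont_diff:
  fixes g :: "real^'d \<Rightarrow> real"
  assumes "twice_cont_diff g"
  shows "continuous_on UNIV g" "continuous_on UNIV (grad g)" "continuous_on UNIV (hess g)"
  using assms by (auto simp: twice_cont_diff_def continuous_on_eq_continuous_within
      intro: differentiable_imp_continuous_within)

lemma continuous_on_jacobian:
  fixes c :: "real^'d \<Rightarrow> real^'m"
  assumes c: "\<And>j. twice_cont_diff (\<lambda>y. c y $ j)"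
  shows "continuous_on UNIV c" "continuous_on UNIV (\<lambda>y. jacobian c (at y))"
proof -
  show "continuous_on UNIV c"
    using continuous_on_twice_cont_diff(1)[OF c]
    by (simp add: continuous_on_vec_lambda[where f = "\<lambda>j y. c y $ j", simplified])
  show "continuous_on UNIV (\<lambda>y. jacobian c (at y))"
    unfolding jacobian_eq_component_grads[of c, OF c]
    by (intro continuous_on_vec_lambda continuous_on_twice_cont_diff c)
qed

lemma borel_measurable_matrix_vector_mult:
  fixes A :: "'w \<Rightarrow> real^'n^'m"
  assumes "A \<in> borel_measurable M" "v \<in> borel_measurable M"
  shows "(\<lambda>w. A w *v v w) \<in> borel_measurable M"
proof (rule borel_measurable_continuous_Pair[OF assms, where H = "(*v)"])
  show "continuous_on UNIV (\<lambda>p :: (real^'n^'m) \<times> (real^'n). fst p *v snd p)"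
    unfolding matrix_vector_mult_def by (intro continuous_intros)
qed

lemma borel_measurable_continuous_compose:
  assumes "x \<in> borel_measurable M" and "continuous_on UNIV g"
  shows "(\<lambda>w. g (x w)) \<in> borel_measurable M"
  using measurable_compose[OF assms(1) borel_measurable_continuous_onI[OF assms(2)]] .

lemma borel_measurable_component:
  fixes v :: "'w \<Rightarrow> real^'m"
  assumes "v \<in> borel_measurable M"
  shows "(\<lambda>w. v w $ j) \<in> borel_measurable M"
  by (rule borel_measurable_continuous_compose[where g = "\<lambda>y. y $ j", OF assms continuous_on_component[OF continuous_on_id]])

lemma borel_measurable_transpose_jacobian_mult:
  fixes c :: "real^'d \<Rightarrow> real^'m"
  assumes c: "\<And>j. twice_cont_diff (\<lambda>y. c y $ j)"
    and x: "x \<in> borel_measurable M" and "v \<in> borel_measurable M"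
  shows "(\<lambda>w. transpose (jacobian c (at (x w))) *v v w) \<in> borel_measurable M"
  unfolding transpose_jacobian_mult[of c, OF c]
  by (intro borel_measurable_sum borel_measurable_scaleR borel_measurable_component assms
      borel_measurable_continuous_compose[OF x] continuous_on_twice_cont_diff)

context
  fixes M :: "'w measure" and X :: "(real^'d) set" and f :: "real^'d \<Rightarrow> real"
    and c :: "real^'d \<Rightarrow> real^'m" and x :: "'w \<Rightarrow> real^'d"
  assumes X: "convex X" "closed X"
    and f: "twice_cont_diff f" and c: "\<And>j. twice_cont_diff (\<lambda>y. c y $ j)"
    and x: "x \<in> borel_measurable M" "\<And>w. w \<in> space M \<Longrightarrow> x w \<in> X"
begin

lemma borel_measurable_lagrangian_hess:
  assumes "v \<in> borel_measurable M"
  shows "(\<lambda>w. (hess f (x w) + (\<Sum>j\<in>UNIV. v w $ j *\<^sub>R hess (\<lambda>y. c y $ j) (x w))) *v u) \<in> borel_measurable M"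
  by (intro borel_measurable_matrix_vector_mult borel_measurable_const borel_measurable_add
      borel_measurable_sum borel_measurable_scaleR borel_measurable_component assms
      borel_measurable_continuous_compose[OF x(1)] continuous_on_twice_cont_diff f c)

lemma borel_measurable_subproblem_residual:
  assumes l: "l \<in> borel_measurable M"
  shows "(\<lambda>w. subproblem_residual X f c \<alpha> (x w) (l w)) \<in> borel_measurable M"
proof -
  note [measurable] = borel_measurable_continuous_compose[OF x(1) continuous_on_twice_cont_diff(2)[OF f]]
    borel_measurable_continuous_compose[OF x(1) continuous_on_jacobian(1)[of c, OF c]] l
  note [measurable] = borel_measurable_transpose_jacobian_mult[of c, OF c x(1)]
    borel_measurable_closest_point_tangent_cone[OF X x]
  show ?thesis
    unfolding subproblem_residual_def grad_aug_lag[OF f c] by measurable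
qed

lemma borel_measurable_subproblem_curv:
  assumes l: "l \<in> borel_measurable M"
  shows "(\<lambda>w. subproblem_curv X f c \<alpha> (x w) (l w)) \<in> borel_measurable M"
proof -
  note [measurable] = borel_measurable_continuous_compose[OF x(1) continuous_on_jacobian(1)[of c, OF c]]
    borel_measurable_continuous_compose[OF x(1) continuous_on_jacobian(2)[of c, OF c]] l
  have "(\<lambda>w. hess (\<lambda>y. aug_lag f c \<alpha> y (l w)) (x w) *v u) \<in> borel_measurable M" for u
  proof -
    have "(\<lambda>w. transpose (jacobian c (at (x w))) *v (jacobian c (at (x w)) *v u)) \<in> borel_measurable M"
      by (intro borel_measurable_transpose_jacobian_mult[of c, OF c x(1)] borel_measurable_matrix_vector_mult) measurable
    moreover have "(\<lambda>w. (hess f (x w) + (\<Sum>j\<in>UNIV. (l w + \<alpha> *\<^sub>R c (x w)) $ j *\<^sub>R hess (\<lambda>y. c y $ j) (x w))) *v u)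
        \<in> borel_measurable M"
      by (intro borel_measurable_lagrangian_hess) measurable
    ultimately show ?thesis
      unfolding hess_aug_lag[OF f c] matrix_vector_mult_add_rdistrib[of _ _ u]
      by (simp add: scaleR_matrix_vector_assoc[symmetric] matrix_vector_mul_assoc[symmetric]
          del: transpose_matrix_vector)
  qed
  from borel_measurable_min_curv[OF X x _ this, of "\<lambda>_. 0 :: real^'d^'m"] show ?thesis
    unfolding subproblem_curv_def by simp
qed

lemma borel_measurable_kkt_curv:
  assumes l: "l \<in> borel_measurable M"
  shows "(\<lambda>w. kkt_curv X f c (x w) (l w)) \<in> borel_measurable M"
  unfolding kkt_curv_def tangent_cone_null_def
  by (intro borel_measurable_min_curv[OF X x] borel_measurable_lagrangian_hess l borel_measurable_const
      borel_measurable_matrix_vector_mult borel_measurable_continuous_compose[OF x(1) continuous_on_jacobian(2)[of c, OF c]])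

end

section \<open>From conditional to unconditional expectations\<close>

lemma ereal_diff_ge_iff_le_add:
  assumes "0 \<le> e"
  shows "- ereal e \<le> enn2ereal a - enn2ereal b \<Longrightarrow> b \<le> a + ennreal e"
    and "b \<noteq> \<infinity> \<Longrightarrow> b \<le> a + ennreal e \<Longrightarrow> - ereal e \<le> enn2ereal a - enn2ereal b"
  using assms
  by (cases a; cases b; simp add: enn2ereal_ennreal ennreal_plus[symmetric] top_ereal_def infinity_ennreal_def
      enn2ereal_top del: ennreal_plus)+

lemma (in sigma_finite_subalgebra) nn_integral_nn_cond_exp:
  assumes "g \<in> borel_measurable M"
  shows "(\<integral>\<^sup>+ w. nn_cond_exp M F g w \<partial>M) = (\<integral>\<^sup>+ w. g w \<partial>M)"
  using nn_cond_exp_intg[of "\<lambda>_. 1" g] assms by simp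

text \<open>The positive and negative parts have to be integrated separately, because either may have infinite
integral. The conditional bound says that the conditional expectation of the negative part exceeds
that of the positive part by at most \<open>e\<close>. Integrating, \<open>E Z\<^sup>- \<le> E Z\<^sup>+ + e\<close>; since one of the two
is finite, \<open>E Z\<^sup>-\<close> is, and a larger variable has an expectation that exists and obeys the same
bound.\<close>

lemma ereal_expectation_ge_if_ereal_cond_exp_ge:
  assumes "prob_space M" and sub: "subalgebra M G" and e: "0 \<le> e"
    and Z: "has_expectation M Z" and cond: "AE w in M. - ereal e \<le> ereal_cond_exp M G Z w"
    and Y: "Y \<in> borel_measurable M" and ZY: "\<And>w. w \<in> space M \<Longrightarrow> Z w \<le> Y w"
  shows "has_expectation M Y" and "- ereal e \<le> ereal_expectation M Y"
proof -
  interpret prob_space M by fact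
  interpret finite_measure_subalgebra M G
    by unfold_locales (rule sub)
  let ?p = "\<lambda>U. \<integral>\<^sup>+ w. e2ennreal (U w) \<partial>M" and ?n = "\<lambda>U. \<integral>\<^sup>+ w. e2ennreal (- U w) \<partial>M"
  have [measurable]: "Z \<in> borel_measurable M"
    using Z by (simp add: has_expectation_def)
  have "AE w in M. nn_cond_exp M G (\<lambda>v. e2ennreal (- Z v)) w
      \<le> nn_cond_exp M G (\<lambda>v. e2ennreal (Z v)) w + ennreal e"
    using cond by eventually_elim (auto simp: ereal_cond_exp_def intro: ereal_diff_ge_iff_le_add(1)[OF e])
  then have "?n Z \<le> (\<integral>\<^sup>+ w. nn_cond_exp M G (\<lambda>v. e2ennreal (Z v)) w + ennreal e \<partial>M)"
    by (subst nn_integral_nn_cond_exp[symmetric]) (auto intro: nn_integral_mono_AE)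
  also have "\<dots> = ?p Z + ennreal e"
    by (simp add: nn_integral_add nn_integral_nn_cond_exp emeasure_space_1)
  finally have Zle: "?n Z \<le> ?p Z + ennreal e" .
  have fin: "?n Z < \<infinity>"
    using Z Zle by (auto simp: has_expectation_def less_top[symmetric] top_unique)
  have n: "?n Y \<le> ?n Z" and p: "?p Z \<le> ?p Y"
    using ZY by (auto intro!: nn_integral_mono e2ennreal_mono)
  have nY: "?n Y < \<infinity>" using n fin by (rule order_le_less_trans)
  then show "has_expectation M Y"
    using Y by (simp add: has_expectation_def)
  have "?n Y \<le> ?p Y + ennreal e"
    using n Zle p by (meson add_right_mono order_trans)
  then show "- ereal e \<le> ereal_expectation M Y"
    unfolding ereal_expectation_def using nY by (intro ereal_diff_ge_iff_le_add(2)[OF e]) auto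
qed

section \<open>The iterates\<close>

lemma subalgebra_history:
  assumes "\<And>k. \<rho> k \<in> measurable M (R k)" and "\<And>k i. i < N k \<Longrightarrow> \<zeta> k i \<in> measurable M P"
  shows "subalgebra M (history M R P N \<rho> \<zeta> k)"
proof -
  have \<rho>: "sets (vimage_algebra (space M) (\<rho> j) (R j)) \<subseteq> sets M" for j
    by (rule sets_image_in_sets[OF refl assms(1)])
  have \<zeta>: "sets (vimage_algebra (space M) (\<zeta> j i) P) \<subseteq> sets M" if "i < N j" for i j
    by (rule sets_image_in_sets[OF refl assms(2)[OF that]])
  let ?A = "(\<Union>j<k. sets (vimage_algebra (space M) (\<rho> j) (R j))) \<union>
      (\<Union>j<k. \<Union>i<N j. sets (vimage_algebra (space M) (\<zeta> j i) P))"
  have A: "?A \<subseteq> sets M"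
    using \<rho> \<zeta> by (intro Un_least UN_least) auto
  then have "sets (history M R P N \<rho> \<zeta> k) = sigma_sets (space M) ?A"
    unfolding history_def using sets.space_closed[of M] by (intro sets_measure_of) blast
  then show ?thesis
    using sets.sigma_sets_subset[OF A] by (simp add: subalgebra_def history_def space_measure_of_conv)
qed

text \<open>The truncation in the dual step bounds its length by \<open>\<gamma>\<close>, however large the sampled constraint
value is.\<close>

lemma norm_dual_update_le:
  assumes "0 \<le> \<alpha>" "0 \<le> \<gamma>"
  shows "norm (dual_update \<alpha> \<gamma> l b) \<le> norm l + \<gamma>"
proof (cases "b = 0")
  case False
  have "norm (min \<alpha> (\<gamma> / norm b) *\<^sub>R b) = min \<alpha> (\<gamma> / norm b) * norm b"
    using assms by simp
  also have "\<dots> \<le> \<gamma> / norm b * norm b"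
    by (intro mult_right_mono) auto
  also have "\<dots> = \<gamma>" using False by simp
  finally show ?thesis
    using False norm_triangle_ineq[of l "min \<alpha> (\<gamma> / norm b) *\<^sub>R b"] by (simp add: dual_update_def)
qed (use assms in \<open>simp add: dual_update_def\<close>)

lemma mescal_runD:
  assumes "mescal_run M X C P R solver \<alpha> \<gamma> N xinit lam0 \<rho> \<zeta> x lam"
  shows "\<rho> k \<in> measurable M (R k)"
    and "(\<lambda>(y, l, r). solver k y l r) \<in> measurable (borel \<Otimes>\<^sub>M borel \<Otimes>\<^sub>M R k) borel"
    and "w \<in> space M \<Longrightarrow> lam 0 w = lam0"
    and "w \<in> space M \<Longrightarrow> x k w = solver k (if k = 0 then xinit else x (k - 1) w) (lam k w) (\<rho> k w)"
    and "w \<in> space M \<Longrightarrow> x k w \<in> X"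
    and "w \<in> space M \<Longrightarrow> lam (Suc k) w =
      dual_update (\<alpha> k) (\<gamma> k) (lam k w) (dual_sample_mean C (N k) (x k w) (\<lambda>i. \<zeta> k i w))"
    and "i < N k \<Longrightarrow> \<zeta> k i \<in> measurable M P"
  using assms unfolding mescal_run_def fresh_iid_samples_def by blast+

lemma mescal_run_multiplier_bound:
  assumes run: "mescal_run M X C P R solver \<alpha> \<gamma> N xinit lam0 \<rho> \<zeta> x lam"
    and \<alpha>: "\<And>k. 0 \<le> \<alpha> k" and \<gamma>: "\<And>k. 0 \<le> \<gamma> k" "\<gamma> sums C\<gamma>" and w: "w \<in> space M"
  shows "norm (lam k w) \<le> norm lam0 + C\<gamma>"
proof -
  have "norm (lam k w) \<le> norm lam0 + sum \<gamma> {..<k}"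
  proof (induction k)
    case 0
    then show ?case using mescal_runD(3)[OF run w] by simp
  next
    case (Suc k)
    have "norm (lam (Suc k) w) \<le> norm (lam k w) + \<gamma> k"
      unfolding mescal_runD(6)[OF run w] by (rule norm_dual_update_le[OF \<alpha> \<gamma>(1)])
    with Suc show ?case by simp
  qed
  moreover have "sum \<gamma> {..<k} \<le> C\<gamma>"
    using sum_le_suminf[of \<gamma> "{..<k}"] \<gamma> by (auto simp: sums_iff)
  ultimately show ?thesis by simp
qed

text \<open>The sampled constraint values and the solver are jointly measurable, so measurability propagates along
the recursion that produces the iterates.\<close>

lemma mescal_run_borel_measurable:
  fixes C :: "real^'d \<Rightarrow> 'z \<Rightarrow> real^'m"
  assumes run: "mescal_run M X C P R solver \<alpha> \<gamma> N xinit lam0 \<rho> \<zeta> x lam"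
    and C: "(\<lambda>(y, s). C y s) \<in> borel_measurable (borel \<Otimes>\<^sub>M P)"
  shows "x k \<in> borel_measurable M" and "lam k \<in> borel_measurable M"
proof -
  let ?prev = "\<lambda>k w. if k = 0 then xinit else x (k - 1) w"
  have x_step: "x k \<in> borel_measurable M"
    if prev: "?prev k \<in> borel_measurable M" and lam: "lam k \<in> borel_measurable M" for k
  proof -
    have "(\<lambda>w. (\<lambda>(y, l, r). solver k y l r) (?prev k w, lam k w, \<rho> k w)) \<in> borel_measurable M"
      by (rule measurable_compose[OF measurable_Pair[OF prev measurable_Pair[OF lam mescal_runD(1)[OF run]]]
            mescal_runD(2)[OF run]])
    then have "(\<lambda>w. solver k (?prev k w) (lam k w) (\<rho> k w)) \<in> borel_measurable M"
      by (simp only: prod.case)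
    then show ?thesis
      by (rule measurable_cong[THEN iffD1, rotated]) (rule mescal_runD(4)[OF run, symmetric])
  qed
  have lam_step: "lam (Suc k) \<in> borel_measurable M"
    if x: "x k \<in> borel_measurable M" and lam: "lam k \<in> borel_measurable M" for k
  proof -
    have "(\<lambda>w. (\<lambda>(y, s). C y s) (x k w, \<zeta> k i w)) \<in> borel_measurable M" if "i < N k" for i
      by (rule measurable_compose[OF measurable_Pair[OF x mescal_runD(7)[OF run that]] C])
    then have sample: "(\<lambda>w. C (x k w) (\<zeta> k i w)) \<in> borel_measurable M" if "i \<in> {..<N k}" for i
      using that by (simp only: prod.case lessThan_iff)
    have mean: "(\<lambda>w. dual_sample_mean C (N k) (x k w) (\<lambda>i. \<zeta> k i w)) \<in> borel_measurable M"
      unfolding dual_sample_mean_def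
      by (rule borel_measurable_scaleR[OF borel_measurable_const borel_measurable_sum[OF sample]])
    have "(\<lambda>b. min (\<alpha> k) (\<gamma> k / norm b) *\<^sub>R b) \<in> borel_measurable (borel :: (real^'m) measure)"
      by measurable
    then have "(\<lambda>b. if b = 0 then 0 else min (\<alpha> k) (\<gamma> k / norm b) *\<^sub>R b) \<in> borel_measurable (borel :: (real^'m) measure)"
      by (intro measurable_If) simp_all
    from borel_measurable_add[OF lam measurable_compose[OF mean this]]
    have "(\<lambda>w. dual_update (\<alpha> k) (\<gamma> k) (lam k w) (dual_sample_mean C (N k) (x k w) (\<lambda>i. \<zeta> k i w)))
        \<in> borel_measurable M"
      unfolding dual_update_def by (rule measurable_cong[THEN iffD1, rotated]) simp
    then show ?thesis
      by (rule measurable_cong[THEN iffD1, rotated]) (rule mescal_runD(6)[OF run, symmetric])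
  qed
  have *: "?prev k \<in> borel_measurable M \<and> lam k \<in> borel_measurable M" for k
  proof (induction k)
    case 0
    have "lam 0 \<in> borel_measurable M"
      by (rule measurable_cong[THEN iffD1, rotated, OF borel_measurable_const])
        (rule mescal_runD(3)[OF run, symmetric])
    then show ?case by simp
  next
    case (Suc k)
    have "?prev (Suc k) = x k" by simp
    then show ?case
      using x_step[of k] lam_step[of k] Suc by metis
  qed
  show "x k \<in> borel_measurable M" "lam k \<in> borel_measurable M"
    using *[of k] x_step[of k] by blast+
qed

section \<open>The iteration threshold\<close>

lemma K_star_bigo:
  assumes \<beta>: "1 < \<beta>" and A: "0 < 1 + \<kappa>gf + \<kappa>gc * \<Lambda>" and B: "0 < Creg * \<alpha>0"
  shows "(\<lambda>\<epsilon>. real_of_int (K_star \<beta> \<kappa>gf \<kappa>gc \<Lambda> Creg \<alpha>0 \<epsilon>)) \<in> O[at_right 0](\<lambda>\<epsilon>. ln (1 / \<epsilon>))"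
proof (rule bigoI)
  let ?A = "1 + \<kappa>gf + \<kappa>gc * \<Lambda>" and ?B = "Creg * \<alpha>0"
  let ?c = "(\<bar>ln (?A / ?B)\<bar> + 1) / ln \<beta> + 1"
  \<comment> \<open>Below \<open>exp (-1)\<close> one has \<open>ln (1 / \<epsilon>) \<ge> 1\<close>, so that additive constants, including the
    one from rounding up, are absorbed into the factor \<open>?c\<close>.\<close>
  have "\<forall>\<^sub>F \<epsilon> in at_right 0. \<epsilon> \<in> {0 <..< exp (-1 :: real)}"
    by (rule eventually_at_right_real) simp
  then show "\<forall>\<^sub>F \<epsilon> in at_right 0. norm (real_of_int (K_star \<beta> \<kappa>gf \<kappa>gc \<Lambda> Creg \<alpha>0 \<epsilon>)) \<le> ?c * norm (ln (1 / \<epsilon>))"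
  proof eventually_elim
    case (elim \<epsilon>)
    then have \<epsilon>: "0 < \<epsilon>" "\<epsilon> < exp (-1)" by auto
    then have "ln \<epsilon> \<le> -1"
      using ln_less_cancel_iff[of \<epsilon> "exp (-1)"] by simp
    then have L: "1 \<le> ln (1 / \<epsilon>)"
      using \<epsilon> by (simp add: ln_div)
    let ?y = "log \<beta> (?A / (?B * \<epsilon>))"
    have lb: "0 < ln \<beta>" using \<beta> by simp
    have "ln (a / (b * \<epsilon>)) = ln (a / b) + ln (1 / \<epsilon>)" if "0 < a" "0 < b" for a b :: real
      using \<epsilon> that by (simp add: ln_div ln_mult)
    from this[OF A B] have "\<bar>?y\<bar> = \<bar>ln (?A / ?B) + ln (1 / \<epsilon>)\<bar> / ln \<beta>"
      using lb by (simp add: log_def)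
    also have "\<dots> \<le> (\<bar>ln (?A / ?B)\<bar> * ln (1 / \<epsilon>) + ln (1 / \<epsilon>)) / ln \<beta>"
    proof (intro divide_right_mono)
      have "\<bar>ln (?A / ?B)\<bar> * 1 \<le> \<bar>ln (?A / ?B)\<bar> * ln (1 / \<epsilon>)"
        using L by (intro mult_left_mono) auto
      then show "\<bar>ln (?A / ?B) + ln (1 / \<epsilon>)\<bar> \<le> \<bar>ln (?A / ?B)\<bar> * ln (1 / \<epsilon>) + ln (1 / \<epsilon>)"
        using L by linarith
    qed (use lb in simp)
    finally have "\<bar>?y\<bar> + 1 \<le> (\<bar>ln (?A / ?B)\<bar> * ln (1 / \<epsilon>) + ln (1 / \<epsilon>)) / ln \<beta> + ln (1 / \<epsilon>)"
      using L by linarith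
    also have "\<dots> = ?c * ln (1 / \<epsilon>)"
      by (simp add: add_divide_distrib distrib_right)
    finally have "\<bar>?y\<bar> + 1 \<le> ?c * ln (1 / \<epsilon>)" .
    moreover have "\<bar>real_of_int \<lceil>?y\<rceil>\<bar> \<le> \<bar>?y\<bar> + 1" by linarith
    moreover have "K_star \<beta> \<kappa>gf \<kappa>gc \<Lambda> Creg \<alpha>0 \<epsilon> = \<lceil>?y\<rceil>"
      by (simp add: K_star_def)
    ultimately show ?case using L by simp
  qed
qed

text \<open>From the threshold on, the penalty parameter is large enough for
\<open>constraint_violation_bound\<close> to bound the constraint violation by \<open>\<epsilon>\<close> as soon as the residual
of the subproblem is at most 1.\<close>

lemma K_star_le_imp_penalty_large:
  assumes "1 < \<beta>" "0 < Creg" "0 < \<alpha>0" "0 < \<epsilon>" and pos: "0 < 1 + \<kappa>gf + \<kappa>gc * \<Lambda>"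
    and K: "K_star \<beta> \<kappa>gf \<kappa>gc \<Lambda> Creg \<alpha>0 \<epsilon> \<le> int K"
  shows "1 + \<kappa>gf + \<kappa>gc * \<Lambda> \<le> Creg * (\<alpha>0 * \<beta> ^ K) * \<epsilon>"
proof -
  let ?A = "1 + \<kappa>gf + \<kappa>gc * \<Lambda>" and ?B = "Creg * \<alpha>0 * \<epsilon>"
  have B: "0 < ?B" using assms by simp
  have "log \<beta> (?A / ?B) \<le> real K"
    using K unfolding K_star_def ceiling_le_iff by simp
  then have "?A / ?B \<le> \<beta> powr real K"
    using assms B by (subst (asm) log_le_iff) auto
  also have "\<dots> = \<beta> ^ K"
    using assms by (simp add: powr_realpow)
  finally show ?thesis
    using B by (simp add: pos_divide_le_eq mult_ac)
qed

section \<open>Stationarity of a single iterate\<close>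

lemma nn_integral_le_of_cond_exp_le:
  assumes "prob_space M" "subalgebra M G" and g: "g \<in> borel_measurable M"
    and cond: "AE w in M. nn_cond_exp M G g w \<le> ennreal e"
  shows "(\<integral>\<^sup>+ w. g w \<partial>M) \<le> ennreal e"
proof -
  interpret prob_space M by fact
  interpret finite_measure_subalgebra M G
    by unfold_locales fact
  have "(\<integral>\<^sup>+ w. g w \<partial>M) = (\<integral>\<^sup>+ w. nn_cond_exp M G g w \<partial>M)"
    using g by (simp add: nn_integral_nn_cond_exp)
  also have "\<dots> \<le> (\<integral>\<^sup>+ w. ennreal e \<partial>M)"
    using cond by (rule nn_integral_mono_AE)
  also have "\<dots> = ennreal e" by (simp add: emeasure_space_1)
  finally show ?thesis .
qed

lemma measure_ge_of_cond_exp_ge: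
  assumes "prob_space M" "subalgebra M G" and E: "E \<in> sets M"
    and cond: "AE w in M. p \<le> real_cond_exp M G (indicat_real E) w"
  shows "p \<le> measure M E"
proof -
  interpret prob_space M by fact
  interpret finite_measure_subalgebra M G
    by unfold_locales fact
  have int: "integrable M (indicat_real E)"
    using E by (intro integrable_real_indicator) (simp_all add: less_top[symmetric])
  have "p = (\<integral>w. p \<partial>M)" by (simp add: prob_space)
  also have "\<dots> \<le> (\<integral>w. real_cond_exp M G (indicat_real E) w \<partial>M)"
    using cond by (intro integral_mono_AE real_cond_exp_int int) auto
  also have "\<dots> = measure M E"
    using E by (simp add: real_cond_exp_int(2)[OF int])
  finally show ?thesis .
qed

text \<open>One iterate whose penalty parameter has passed the threshold. The measure \<open>G\<close> stands for the
information that is available before the iterate is computed.\<close>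

locale regular_iterate = prob_space M
  for M :: "'w measure" +
  fixes G :: "'w measure" and X :: "(real^'d) set"
    and f :: "real^'d \<Rightarrow> real" and c :: "real^'d \<Rightarrow> real^'m"
    and x :: "'w \<Rightarrow> real^'d" and l :: "'w \<Rightarrow> real^'m"
    and \<alpha> \<kappa>gf \<kappa>gc \<Lambda> Creg \<epsilon>g :: real
  assumes subalg: "subalgebra M G"
    and X: "convex X" "closed X"
    and f: "twice_cont_diff f" and c: "\<And>j. twice_cont_diff (\<lambda>y. c y $ j)"
    and x: "x \<in> borel_measurable M" "\<And>w. w \<in> space M \<Longrightarrow> x w \<in> X"
    and l: "l \<in> borel_measurable M" "\<And>w. w \<in> space M \<Longrightarrow> norm (l w) \<le> \<Lambda>"
    and bounds: "\<And>y. y \<in> X \<Longrightarrow> norm (grad f y) \<le> \<kappa>gf"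
      "\<And>y. y \<in> X \<Longrightarrow> onorm ((*v) (jacobian c (at y))) \<le> \<kappa>gc"
      "0 \<le> \<kappa>gf" "0 \<le> \<kappa>gc" "0 \<le> \<Lambda>"
    and reg: "0 < Creg" "\<And>y. y \<in> X \<Longrightarrow> Creg * norm (c y) \<le>
          norm (closest_point (tangent_cone X y) (- (transpose (jacobian c (at y)) *v c y)))"
    and \<alpha>: "0 < \<alpha>" "1 + \<kappa>gf + \<kappa>gc * \<Lambda> \<le> Creg * \<alpha> * \<epsilon>g"
begin

lemma shifted_multiplier_measurable: "(\<lambda>w. l w + \<alpha> *\<^sub>R c (x w)) \<in> borel_measurable M"
  by (intro borel_measurable_add borel_measurable_scaleR borel_measurable_const l
      borel_measurable_continuous_compose[OF x(1) continuous_on_jacobian(1)[of c, OF c]])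

lemma norm_constraint_measurable: "(\<lambda>w. norm (c (x w))) \<in> borel_measurable M"
  using borel_measurable_continuous_compose[OF x(1) continuous_on_jacobian(1)[of c, OF c]] by measurable

lemma residual_measurable: "(\<lambda>w. subproblem_residual X f c \<alpha> (x w) (l w)) \<in> borel_measurable M"
  using borel_measurable_subproblem_residual[OF X f c x l(1)] .

lemma kkt_curv_measurable:
  "(\<lambda>w. kkt_curv X f c (x w) (l w + \<alpha> *\<^sub>R c (x w))) \<in> borel_measurable M"
  using borel_measurable_kkt_curv[OF X f c x shifted_multiplier_measurable] .

lemma random_pair: "random_pair M X x (\<lambda>w. l w + \<alpha> *\<^sub>R c (x w))"
  using x shifted_multiplier_measurable by (simp add: random_pair_def)

lemma constraint_le:
  assumes "w \<in> space M"
  shows "Creg * \<alpha> * norm (c (x w)) \<le>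
    subproblem_residual X f c \<alpha> (x w) (l w) + (\<kappa>gf + \<kappa>gc * \<Lambda>)"
  using assms by (intro constraint_violation_bound f c X x \<alpha> bounds l reg)

lemma expected_sosp_if_option_I:
  assumes opt: "option_I M G X f c \<alpha> e e' x l" and e: "0 < e" "e \<le> \<epsilon>g" "\<epsilon>g < 1" "0 < e'" "e' \<le> \<epsilon>H"
  shows "expected_sosp M X f c \<epsilon>g \<epsilon>H x (\<lambda>w. l w + \<alpha> *\<^sub>R c (x w))"
proof -
  let ?r = "\<lambda>w. subproblem_residual X f c \<alpha> (x w) (l w)" and ?D = "Creg * \<alpha>" and ?B = "\<kappa>gf + \<kappa>gc * \<Lambda>"
  note [measurable] = residual_measurable norm_constraint_measurable
  have D: "0 < ?D" using reg \<alpha> by simp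
  have B: "0 \<le> ?B" using bounds by simp
  have r0: "0 \<le> ?r w" for w by (simp add: subproblem_residual_def)
  have "(\<integral>\<^sup>+ w. ennreal (?r w) \<partial>M) \<le> ennreal e"
    using opt by (intro nn_integral_le_of_cond_exp_le[OF prob_space_axioms subalg]) (auto simp: option_I_def)
  also have "\<dots> \<le> ennreal \<epsilon>g" using e by (simp add: ennreal_leI)
  finally have r: "(\<integral>\<^sup>+ w. ennreal (?r w) \<partial>M) \<le> ennreal \<epsilon>g" .
  have "(\<integral>\<^sup>+ w. ennreal (norm (c (x w))) \<partial>M) \<le> (\<integral>\<^sup>+ w. ennreal (1 / ?D) * (ennreal (?r w) + ennreal ?B) \<partial>M)"
  proof (rule nn_integral_mono)
    fix w assume "w \<in> space M"
    then have "norm (c (x w)) \<le> 1 / ?D * (?r w + ?B)"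
      using constraint_le D by (simp add: pos_le_divide_eq mult.commute)
    then have "ennreal (norm (c (x w))) \<le> ennreal (1 / ?D * (?r w + ?B))"
      by (rule ennreal_leI)
    also have "\<dots> = ennreal (1 / ?D) * (ennreal (?r w) + ennreal ?B)"
      using D B r0[of w] by (subst ennreal_mult) (auto simp: ennreal_plus)
    finally show "ennreal (norm (c (x w))) \<le> ennreal (1 / ?D) * (ennreal (?r w) + ennreal ?B)" .
  qed
  also have "\<dots> = ennreal (1 / ?D) * ((\<integral>\<^sup>+ w. ennreal (?r w) \<partial>M) + ennreal ?B)"
    by (simp add: nn_integral_cmult nn_integral_add emeasure_space_1)
  also have "\<dots> \<le> ennreal (1 / ?D) * (ennreal \<epsilon>g + ennreal ?B)"
    using r by (intro mult_left_mono add_right_mono) auto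
  also have "\<dots> = ennreal (1 / ?D * (\<epsilon>g + ?B))"
    using D B e by (subst ennreal_mult) (auto simp: ennreal_plus)
  also have "\<dots> \<le> ennreal \<epsilon>g"
    using \<alpha>(2) D e by (intro ennreal_leI) (simp add: pos_divide_le_eq mult.commute)
  finally have cn: "(\<integral>\<^sup>+ w. ennreal (norm (c (x w))) \<partial>M) \<le> ennreal \<epsilon>g" .
  have curv: "has_expectation M (\<lambda>w. kkt_curv X f c (x w) (l w + \<alpha> *\<^sub>R c (x w)))"
    "- ereal e' \<le> ereal_expectation M (\<lambda>w. kkt_curv X f c (x w) (l w + \<alpha> *\<^sub>R c (x w)))"
    using opt e ereal_expectation_ge_if_ereal_cond_exp_ge[OF prob_space_axioms subalg, of e'
        "\<lambda>w. subproblem_curv X f c \<alpha> (x w) (l w)", OF _ _ _ kkt_curv_measurable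
        subproblem_curv_le_kkt_curv[OF f c]]
    by (auto simp: option_I_def)
  have "- ereal \<epsilon>H \<le> - ereal e'" using e by simp
  note order_trans[OF this curv(2)]
  then show ?thesis
    unfolding expected_sosp_def kkt_residual_shifted_multiplier[OF f c]
    using random_pair r cn curv(1) by blast
qed

lemma probabilistic_sosp_if_option_II:
  assumes opt: "option_II M G X f c \<alpha> e e' p x l" and e: "e \<le> \<epsilon>g" "\<epsilon>g < 1" "e' \<le> \<epsilon>H"
  shows "probabilistic_sosp M X f c \<epsilon>g \<epsilon>H p x (\<lambda>w. l w + \<alpha> *\<^sub>R c (x w))"
proof -
  let ?r = "\<lambda>w. subproblem_residual X f c \<alpha> (x w) (l w)"
  let ?E = "{w \<in> space M. ?r w \<le> e \<and> - ereal e' \<le> subproblem_curv X f c \<alpha> (x w) (l w)}"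
  let ?E' = "{w \<in> space M. kkt_residual X f c (x w) (l w + \<alpha> *\<^sub>R c (x w)) \<le> \<epsilon>g \<and> norm (c (x w)) \<le> \<epsilon>g \<and>
      - ereal \<epsilon>H \<le> kkt_curv X f c (x w) (l w + \<alpha> *\<^sub>R c (x w))}"
  note [measurable] = residual_measurable norm_constraint_measurable kkt_curv_measurable
    borel_measurable_subproblem_curv[OF X f c x l(1), of \<alpha>]
  have "p \<le> measure M ?E"
    using opt by (intro measure_ge_of_cond_exp_ge[OF prob_space_axioms subalg]) (auto simp: option_II_def)
  also have "\<dots> \<le> measure M ?E'"
  proof (rule finite_measure_mono)
    show "?E' \<in> sets M"
      unfolding kkt_residual_shifted_multiplier[OF f c] by measurable
    show "?E \<subseteq> ?E'"
    proof
      fix w assume w: "w \<in> ?E"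
      have "Creg * \<alpha> * norm (c (x w)) \<le> 1 + \<kappa>gf + \<kappa>gc * \<Lambda>"
        using constraint_le[of w] w e by auto
      also note \<alpha>(2)
      finally have "norm (c (x w)) \<le> \<epsilon>g"
        using \<alpha>(1) reg(1) by simp
      moreover have "- ereal \<epsilon>H \<le> kkt_curv X f c (x w) (l w + \<alpha> *\<^sub>R c (x w))"
      proof -
        have "- ereal \<epsilon>H \<le> - ereal e'" using e by simp
        also have "\<dots> \<le> subproblem_curv X f c \<alpha> (x w) (l w)" using w by simp
        also note subproblem_curv_le_kkt_curv[OF f c]
        finally show ?thesis .
      qed
      ultimately show "w \<in> ?E'"
        using w e by (auto simp: kkt_residual_shifted_multiplier[OF f c])
    qed
  qed
  finally show ?thesis
    using random_pair by (simp add: probabilistic_sosp_def)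
qed

end

section \<open>Second-order stationarity of the iterates\<close>

theorem theorem2p1:
  fixes M :: "'w measure" and P\<xi> :: "'x measure" and P\<zeta> :: "'z measure"
    and X :: "(real^'d) set"
    and F :: "real^'d \<Rightarrow> 'x \<Rightarrow> real" and f :: "real^'d \<Rightarrow> real"
    and C :: "real^'d \<Rightarrow> 'z \<Rightarrow> real^'m" and c :: "real^'d \<Rightarrow> real^'m"
    and R :: "nat \<Rightarrow> 'r measure"
    and solver :: "nat \<Rightarrow> real^'d \<Rightarrow> real^'m \<Rightarrow> 'r \<Rightarrow> real^'d"
    and \<rho> :: "nat \<Rightarrow> 'w \<Rightarrow> 'r" and \<zeta> :: "nat \<Rightarrow> nat \<Rightarrow> 'w \<Rightarrow> 'z"
    and x :: "nat \<Rightarrow> 'w \<Rightarrow> real^'d" and lam :: "nat \<Rightarrow> 'w \<Rightarrow> real^'m"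
    and xinit :: "real^'d" and lam0 :: "real^'m"
    and \<epsilon>gk \<epsilon>Hk pk \<gamma> \<alpha> :: "nat \<Rightarrow> real" and N :: "nat \<Rightarrow> nat"
    and \<alpha>0 \<beta> \<epsilon>g \<epsilon>H C\<gamma> Creg \<Lambda> \<kappa>f \<kappa>gf \<kappa>c \<kappa>gc \<kappa>hc :: real
  assumes "prob_space M" and "prob_space P\<xi>" and "prob_space P\<zeta>"
    \<comment> \<open>problem data\<close>
    and "closed X" and "convex X"
    and "\<And>y. integrable P\<xi> (F y)" and "\<And>y. f y = (\<integral>s. F y s \<partial>P\<xi>)"
    and "(\<lambda>(y, s). C y s) \<in> borel_measurable (borel \<Otimes>\<^sub>M P\<zeta>)"
    and "\<And>y. integrable P\<zeta> (C y)" and "\<And>y. c y = (\<integral>s. C y s \<partial>P\<zeta>)"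
    and "twice_cont_diff f" and "\<And>j. twice_cont_diff (\<lambda>y. c y $ j)"
    \<comment> \<open>boundedness and regularity\<close>
    and "\<kappa>f > 0" and "\<kappa>gf > 0" and "\<kappa>c > 0" and "\<kappa>gc > 0" and "\<kappa>hc > 0"
    and "\<And>y. y \<in> X \<Longrightarrow> \<bar>f y\<bar> \<le> \<kappa>f"
    and "\<And>y. y \<in> X \<Longrightarrow> norm (grad f y) \<le> \<kappa>gf"
    and "\<And>y. y \<in> X \<Longrightarrow> norm (c y) \<le> \<kappa>c"
    and "\<And>y. y \<in> X \<Longrightarrow> onorm ((*v) (jacobian c (at y))) \<le> \<kappa>gc"
    and "\<And>y. y \<in> X \<Longrightarrow> bilinear_norm (second_deriv c y) \<le> \<kappa>hc"
    and "Creg > 0"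
    and "\<And>y. y \<in> X \<Longrightarrow> Creg * norm (c y) \<le>
          norm (closest_point (tangent_cone X y) (- (transpose (jacobian c (at y)) *v c y)))"
    \<comment> \<open>algorithm parameters\<close>
    and "xinit \<in> X" and "\<alpha>0 > 0" and "\<beta> > 1" and "\<And>k. \<alpha> k = \<alpha>0 * \<beta> ^ k"
    and "\<And>k. \<gamma> k > 0" and "Bseq \<gamma>" and "\<gamma> sums C\<gamma>"
    and "\<And>k. N k \<ge> 1"
    and "\<And>k. 0 < \<epsilon>gk k \<and> \<epsilon>gk k \<le> \<epsilon>g" and "\<epsilon>g < 1"
    and "\<And>k. 0 < \<epsilon>Hk k \<and> \<epsilon>Hk k \<le> \<epsilon>H" and "\<epsilon>H < 1"
    and "\<And>k. 0 \<le> pk k \<and> pk k \<le> 1"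
    and "\<Lambda> = norm lam0 + C\<gamma>"
    \<comment> \<open>the iterates\<close>
    and "mescal_run M X C P\<zeta> R solver \<alpha> \<gamma> N xinit lam0 \<rho> \<zeta> x lam"
  shows "(\<lambda>\<epsilon>. real_of_int (K_star \<beta> \<kappa>gf \<kappa>gc \<Lambda> Creg \<alpha>0 \<epsilon>)) \<in> O[at_right 0](\<lambda>\<epsilon>. ln (1 / \<epsilon>)) \<and>
    (\<forall>K. int K \<ge> K_star \<beta> \<kappa>gf \<kappa>gc \<Lambda> Creg \<alpha>0 \<epsilon>g \<longrightarrow>
      ((\<forall>k. option_I M (history M R P\<zeta> N \<rho> \<zeta> k) X f c (\<alpha> k) (\<epsilon>gk k) (\<epsilon>Hk k) (x k) (lam k)) \<longrightarrow>
         expected_sosp M X f c \<epsilon>g \<epsilon>H (x K) (\<lambda>w. lam K w + \<alpha> K *\<^sub>R c (x K w))) \<and>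
      (\<forall>p. (\<forall>k. pk k = p) \<and>
           (\<forall>k. option_II M (history M R P\<zeta> N \<rho> \<zeta> k) X f c (\<alpha> k) (\<epsilon>gk k) (\<epsilon>Hk k) (pk k) (x k) (lam k)) \<longrightarrow>
         probabilistic_sosp M X f c \<epsilon>g \<epsilon>H p (x K) (\<lambda>w. lam K w + \<alpha> K *\<^sub>R c (x K w))))"
proof -
  interpret P: prob_space M by fact
  note run = \<open>mescal_run M X C P\<zeta> R solver \<alpha> \<gamma> N xinit lam0 \<rho> \<zeta> x lam\<close>
  note \<alpha>_eq = \<open>\<And>k. \<alpha> k = \<alpha>0 * \<beta> ^ k\<close>
  have \<alpha>: "0 < \<alpha> k" for k
    using \<open>\<alpha>0 > 0\<close> \<open>\<beta> > 1\<close> by (simp add: \<alpha>_eq)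
  have \<gamma>: "0 \<le> \<gamma> k" for k
    using less_imp_le[OF \<open>\<And>k. \<gamma> k > 0\<close>] .
  have "0 \<le> C\<gamma>"
    using \<gamma> \<open>\<gamma> sums C\<gamma>\<close> suminf_nonneg[of \<gamma>] by (auto simp: sums_iff)
  then have \<Lambda>: "0 \<le> \<Lambda>"
    using \<open>\<Lambda> = norm lam0 + C\<gamma>\<close> by simp
  then have A: "0 < 1 + \<kappa>gf + \<kappa>gc * \<Lambda>"
    using \<open>\<kappa>gf > 0\<close> \<open>\<kappa>gc > 0\<close> by (intro add_pos_nonneg) auto
  have \<epsilon>g: "0 < \<epsilon>g"
    using \<open>\<And>k. 0 < \<epsilon>gk k \<and> \<epsilon>gk k \<le> \<epsilon>g\<close>[of 0] by linarith
  have iterate: "regular_iterate M (history M R P\<zeta> N \<rho> \<zeta> K) X f c (x K) (lam K) (\<alpha> K) \<kappa>gf \<kappa>gc \<Lambda> Creg \<epsilon>g"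
    if "int K \<ge> K_star \<beta> \<kappa>gf \<kappa>gc \<Lambda> Creg \<alpha>0 \<epsilon>g" for K
  proof unfold_locales
    show "subalgebra M (history M R P\<zeta> N \<rho> \<zeta> K)"
      by (intro subalgebra_history mescal_runD[OF run])
    show "x K \<in> borel_measurable M" "lam K \<in> borel_measurable M"
      using mescal_run_borel_measurable[OF run] assms(8) by auto
    show "x K w \<in> X" if "w \<in> space M" for w
      using mescal_runD(5)[OF run that] .
    show "norm (lam K w) \<le> \<Lambda>" if "w \<in> space M" for w
      unfolding \<open>\<Lambda> = norm lam0 + C\<gamma>\<close>
      using mescal_run_multiplier_bound[OF run less_imp_le[OF \<alpha>] \<gamma> \<open>\<gamma> sums C\<gamma>\<close> that] .
    show "1 + \<kappa>gf + \<kappa>gc * \<Lambda> \<le> Creg * \<alpha> K * \<epsilon>g"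
      unfolding \<alpha>_eq by (rule K_star_le_imp_penalty_large) (fact \<open>\<beta> > 1\<close> \<open>Creg > 0\<close> \<open>\<alpha>0 > 0\<close> \<epsilon>g A that)+
  qed (use assms \<alpha> \<Lambda> in \<open>simp_all add: less_imp_le\<close>)
  show ?thesis
  proof (intro conjI allI impI)
    show "(\<lambda>\<epsilon>. real_of_int (K_star \<beta> \<kappa>gf \<kappa>gc \<Lambda> Creg \<alpha>0 \<epsilon>)) \<in> O[at_right 0](\<lambda>\<epsilon>. ln (1 / \<epsilon>))"
      using \<open>\<beta> > 1\<close> A \<open>Creg > 0\<close> \<open>\<alpha>0 > 0\<close> by (intro K_star_bigo) auto
  next
    fix K
    assume K: "int K \<ge> K_star \<beta> \<kappa>gf \<kappa>gc \<Lambda> Creg \<alpha>0 \<epsilon>g"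
      and opt: "\<forall>k. option_I M (history M R P\<zeta> N \<rho> \<zeta> k) X f c (\<alpha> k) (\<epsilon>gk k) (\<epsilon>Hk k) (x k) (lam k)"
    interpret regular_iterate M "history M R P\<zeta> N \<rho> \<zeta> K" X f c "x K" "lam K" "\<alpha> K" \<kappa>gf \<kappa>gc \<Lambda> Creg \<epsilon>g
      using K by (rule iterate)
    show "expected_sosp M X f c \<epsilon>g \<epsilon>H (x K) (\<lambda>w. lam K w + \<alpha> K *\<^sub>R c (x K w))"
      using opt \<open>\<And>k. 0 < \<epsilon>gk k \<and> \<epsilon>gk k \<le> \<epsilon>g\<close> \<open>\<epsilon>g < 1\<close> \<open>\<And>k. 0 < \<epsilon>Hk k \<and> \<epsilon>Hk k \<le> \<epsilon>H\<close>
      by (intro expected_sosp_if_option_I[of "\<epsilon>gk K" "\<epsilon>Hk K"]) auto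
  next
    fix K p
    assume K: "int K \<ge> K_star \<beta> \<kappa>gf \<kappa>gc \<Lambda> Creg \<alpha>0 \<epsilon>g"
      and opt: "(\<forall>k. pk k = p) \<and>
        (\<forall>k. option_II M (history M R P\<zeta> N \<rho> \<zeta> k) X f c (\<alpha> k) (\<epsilon>gk k) (\<epsilon>Hk k) (pk k) (x k) (lam k))"
    interpret regular_iterate M "history M R P\<zeta> N \<rho> \<zeta> K" X f c "x K" "lam K" "\<alpha> K" \<kappa>gf \<kappa>gc \<Lambda> Creg \<epsilon>g
      using K by (rule iterate)
    have "option_II M (history M R P\<zeta> N \<rho> \<zeta> K) X f c (\<alpha> K) (\<epsilon>gk K) (\<epsilon>Hk K) p (x K) (lam K)"
      using opt by metis
    then show "probabilistic_sosp M X f c \<epsilon>g \<epsilon>H p (x K) (\<lambda>w. lam K w + \<alpha> K *\<^sub>R c (x K w))"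
      using \<open>\<And>k. 0 < \<epsilon>gk k \<and> \<epsilon>gk k \<le> \<epsilon>g\<close> \<open>\<epsilon>g < 1\<close> \<open>\<And>k. 0 < \<epsilon>Hk k \<and> \<epsilon>Hk k \<le> \<epsilon>H\<close>
      by (intro probabilistic_sosp_if_option_II[of "\<epsilon>gk K" "\<epsilon>Hk K" p]) auto
  qed
qed

end
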